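(* Let $\phi$ be a positive automorphism of a free group $F$ with finite basis $a_1,\dots,a_m$ satisfying the conditioning properties (1)–(5) listed in the context. There exists a constant $T_0'$, depending only on $\phi$, with the following property: if $U$ and $V$ are positive words, $V$ begins with a non-constant letter and $\phi^k(UV^{-1})$ is positive for some $k>0$, then the least such $k$ is less than $T_0'$.
   Context: A word is positive if none of its letters are inverses $a_j^{-1}$; an element of $F$ is positive if its reduced word is; $\phi$ is positive if each $\phi(a_i)$ is positive. A letter $x$ is constant if $\phi(x)=x$. Supports and strata: for a basis letter $x$, $\mathrm{Supp}(x)$ is the set of letters appearing in $\phi^j(x)$ for some $j\ge0$; $\Sigma(x)=\{y\in\mathrm{Supp}(x):\mathrm{Supp}(y)=\mathrm{Supp}(x)\}$; $x$ is exponential if $\Sigma(x)=\Sigma(y)$ for some $y\neq x$. Conditioning properties assumed of $\phi$: (1) each letter $x$ appears in $\phi(x)$; (2) each exponential letter $x$ appears at least 3 times in $\phi(x)$; (3) for all $x$, each $y\in\mathrm{Supp}(x)$ appears in $\phi(x)$; (4) for all $x$ and $j\ge1$ the leftmost and rightmost letters of $\phi^j(x)$ are the same as those of $\phi(x)$; (5) for all $x$, $j\ge1$ and all strata $\Sigma\subseteq\mathrm{Supp}(x)$, the leftmost (resp. rightmost) letter from $\Sigma$ in $\phi^j(x)$ is the same as the leftmost (resp. rightmost) letter from $\Sigma$ in $\phi(x)$. *)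

theory Defs
  imports "HOL-Algebra.Group"
begin

datatype 'a letter = Pos 'a | Neg 'a

fun letter_inv :: "'a letter \<Rightarrow> 'a letter" where
  "letter_inv (Pos x) = Neg x"
| "letter_inv (Neg x) = Pos x"

type_synonym 'a word = "'a letter list"

definition words :: "'a set \<Rightarrow> 'a word set" where
  "words A = lists (Pos ` A \<union> Neg ` A)"

definition reduced :: "'a word \<Rightarrow> bool" where
  "reduced w \<longleftrightarrow> successively (\<lambda>l l'. l' \<noteq> letter_inv l) w"

definition positive_word :: "'a word \<Rightarrow> bool" where
  "positive_word w \<longleftrightarrow> (\<forall>x. Neg x \<notin> set w)"

fun letter_value :: "('a, 'b) monoid_scheme \<Rightarrow> 'a letter \<Rightarrow> 'a" where
  "letter_value F (Pos x) = x"
| "letter_value F (Neg x) = inv\<^bsub>F\<^esub> x"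

fun word_value :: "('a, 'b) monoid_scheme \<Rightarrow> 'a word \<Rightarrow> 'a" where
  "word_value F [] = \<one>\<^bsub>F\<^esub>"
| "word_value F (l # w) = letter_value F l \<otimes>\<^bsub>F\<^esub> word_value F w"

text \<open>\<open>F\<close> is a free group with basis \<open>A\<close>: every element is represented by exactly one
  reduced word over \<open>A\<close>.\<close>

definition free_group_on :: "('a, 'b) monoid_scheme \<Rightarrow> 'a set \<Rightarrow> bool" where
  "free_group_on F A \<longleftrightarrow> group F \<and> A \<subseteq> carrier F \<and>
     (\<forall>g\<in>carrier F. \<exists>!w. w \<in> words A \<and> reduced w \<and> word_value F w = g)"

definition reduced_word :: "('a, 'b) monoid_scheme \<Rightarrow> 'a set \<Rightarrow> 'a \<Rightarrow> 'a word" where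
  "reduced_word F A g = (THE w. w \<in> words A \<and> reduced w \<and> word_value F w = g)"

definition positive_element :: "('a, 'b) monoid_scheme \<Rightarrow> 'a set \<Rightarrow> 'a \<Rightarrow> bool" where
  "positive_element F A g \<longleftrightarrow> positive_word (reduced_word F A g)"

definition positive_map :: "('a, 'b) monoid_scheme \<Rightarrow> 'a set \<Rightarrow> ('a \<Rightarrow> 'a) \<Rightarrow> bool" where
  "positive_map F A \<phi> \<longleftrightarrow> (\<forall>x\<in>A. positive_element F A (\<phi> x))"

text \<open>The definitions below are meant for positive \<open>\<phi>\<close>, so that only letters of the form
  \<open>Pos x\<close> occur in the words \<open>image_word F A \<phi> j x\<close>.\<close>

definition image_word ::
    "('a, 'b) monoid_scheme \<Rightarrow> 'a set \<Rightarrow> ('a \<Rightarrow> 'a) \<Rightarrow> nat \<Rightarrow> 'a \<Rightarrow> 'a word" where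
  "image_word F A \<phi> j x = reduced_word F A ((\<phi> ^^ j) x)"

definition Supp :: "('a, 'b) monoid_scheme \<Rightarrow> 'a set \<Rightarrow> ('a \<Rightarrow> 'a) \<Rightarrow> 'a \<Rightarrow> 'a set" where
  "Supp F A \<phi> x = {y. \<exists>j. Pos y \<in> set (image_word F A \<phi> j x)}"

definition stratum :: "('a, 'b) monoid_scheme \<Rightarrow> 'a set \<Rightarrow> ('a \<Rightarrow> 'a) \<Rightarrow> 'a \<Rightarrow> 'a set" where
  "stratum F A \<phi> x = {y \<in> Supp F A \<phi> x. Supp F A \<phi> y = Supp F A \<phi> x}"

definition exponential :: "('a, 'b) monoid_scheme \<Rightarrow> 'a set \<Rightarrow> ('a \<Rightarrow> 'a) \<Rightarrow> 'a \<Rightarrow> bool" where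
  "exponential F A \<phi> x \<longleftrightarrow> (\<exists>y\<in>A. y \<noteq> x \<and> stratum F A \<phi> x = stratum F A \<phi> y)"

definition leftmost_from :: "'a set \<Rightarrow> 'a word \<Rightarrow> 'a letter option" where
  "leftmost_from S w = find (\<lambda>l. l \<in> Pos ` S) w"

definition rightmost_from :: "'a set \<Rightarrow> 'a word \<Rightarrow> 'a letter option" where
  "rightmost_from S w = find (\<lambda>l. l \<in> Pos ` S) (rev w)"

definition conditioned :: "('a, 'b) monoid_scheme \<Rightarrow> 'a set \<Rightarrow> ('a \<Rightarrow> 'a) \<Rightarrow> bool" where
  "conditioned F A \<phi> \<longleftrightarrow>
     (\<forall>x\<in>A. Pos x \<in> set (image_word F A \<phi> 1 x)) \<and>
     (\<forall>x\<in>A. exponential F A \<phi> x \<longrightarrow> 3 \<le> count_list (image_word F A \<phi> 1 x) (Pos x)) \<and>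
     (\<forall>x\<in>A. \<forall>y\<in>Supp F A \<phi> x. Pos y \<in> set (image_word F A \<phi> 1 x)) \<and>
     (\<forall>x\<in>A. \<forall>j\<ge>1.
        hd (image_word F A \<phi> j x) = hd (image_word F A \<phi> 1 x) \<and>
        last (image_word F A \<phi> j x) = last (image_word F A \<phi> 1 x)) \<and>
     (\<forall>x\<in>A. \<forall>j\<ge>1. \<forall>S \<in> stratum F A \<phi> ` A. S \<subseteq> Supp F A \<phi> x \<longrightarrow>
        leftmost_from S (image_word F A \<phi> j x) = leftmost_from S (image_word F A \<phi> 1 x) \<and>
        rightmost_from S (image_word F A \<phi> j x) = rightmost_from S (image_word F A \<phi> 1 x))"

end

theory Submission
  imports Defs "HOL-Library.Sublist"
begin

text \<open>Read words backwards, so that \<open>\<phi>\<^sup>k(U V\<^sup>-\<^sup>1)\<close> is positive iff \<open>\<phi>\<^sup>k(V)\<close> is a prefix of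
  \<open>\<phi>\<^sup>k(U)\<close>; call \<open>V\<close> absorbed by \<open>U\<close> if this holds for some \<open>k\<close>. Let \<open>S\<close> be a set of letters with
  \<open>\<phi>(S)\<close> a subset of \<open>S\<^sup>*\<close>. If \<open>V\<close> is absorbed by \<open>U\<close>, common prefixes modulo \<open>S\<close> are genuine
  common prefixes. We show, for every such \<open>S\<close> containing the constant letters, that the absorption
  modulo \<open>S\<close> takes bounded time, by downward induction on \<open>S\<close>. Let \<open>S'\<close> consist of the letters
  \<open>x\<close> with \<open>\<phi>(x)\<close> in \<open>S\<^sup>* x S\<^sup>*\<close>. If \<open>S' = S\<close>, lengths modulo \<open>S\<close> double, and bounded cancellation
  turns the process into a finite state machine. Otherwise the part of \<open>V\<close> outside \<open>S'\<close> is
  absorbed in bounded time by induction, and what is left is a word over \<open>S'\<close>. By condition (5)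
  the first letter \<open>z\<close> of \<open>U\<close> outside \<open>S'\<close> may be assumed to satisfy \<open>\<phi>(z) = p z s\<close> with \<open>p\<close> in
  \<open>S'\<^sup>*\<close>, and comparing gaps between letters of \<open>S' - S\<close> shows that only boundedly many copies of
  \<open>p\<close> can be used. Finally, if \<open>V\<close> ends (in the backwards reading) with a non-constant letter,
  the constant letters left over at the end form a word of bounded length.\<close>

section \<open>Extending substitutions to words\<close>

definition ext :: "('a \<Rightarrow> 'a list) \<Rightarrow> 'a list \<Rightarrow> 'a list" where
  "ext h w = concat (map h w)"

lemma ext_Nil [simp]: "ext h [] = []"
  and ext_Cons [simp]: "ext h (x # w) = h x @ ext h w"
  and ext_append [simp]: "ext h (u @ v) = ext h u @ ext h v"
  by (simp_all add: ext_def)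

lemma ext_pow_append [simp]: "(ext h ^^ k) (u @ v) = (ext h ^^ k) u @ (ext h ^^ k) v"
  by (induction k) simp_all

lemma ext_pow_Nil [simp]: "(ext h ^^ k) [] = []"
  by (induction k) simp_all

lemma ext_pow_Cons: "(ext h ^^ k) (x # w) = (ext h ^^ k) [x] @ (ext h ^^ k) w"
  using ext_pow_append[of k h "[x]" w] by simp

lemma ext_pow_add: "(ext h ^^ (i + j)) w = (ext h ^^ i) ((ext h ^^ j) w)"
  by (simp add: funpow_add)

lemma set_ext: "set (ext h w) = (\<Union>x\<in>set w. set (h x))"
  by (simp add: ext_def)

lemma prefix_ext_pow: "prefix v u \<Longrightarrow> prefix ((ext h ^^ k) v) ((ext h ^^ k) u)"
  by (auto simp: prefix_def)

section \<open>Supports and strata for a substitution on letters\<close>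

definition letter_supp :: "('a \<Rightarrow> 'a list) \<Rightarrow> 'a \<Rightarrow> 'a set" where
  "letter_supp h x = {y. \<exists>j. y \<in> set ((ext h ^^ j) [x])}"

definition letter_stratum :: "('a \<Rightarrow> 'a list) \<Rightarrow> 'a \<Rightarrow> 'a set" where
  "letter_stratum h x = {y \<in> letter_supp h x. letter_supp h y = letter_supp h x}"

lemma letter_supp_refl: "x \<in> letter_supp h x"
  unfolding letter_supp_def by (auto intro: exI[of _ 0])

lemma letter_supp_trans:
  assumes "y \<in> letter_supp h x" shows "letter_supp h y \<subseteq> letter_supp h x"
proof
  fix t assume "t \<in> letter_supp h y"
  then obtain j where j: "t \<in> set ((ext h ^^ j) [y])"
    by (auto simp: letter_supp_def)
  obtain i where "y \<in> set ((ext h ^^ i) [x])"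
    using assms by (auto simp: letter_supp_def)
  then obtain a b where ab: "(ext h ^^ i) [x] = a @ y # b"
    by (meson split_list)
  have "t \<in> set ((ext h ^^ (j + i)) [x])"
    using j by (simp add: ext_pow_add ab ext_pow_Cons[of j h y b])
  then show "t \<in> letter_supp h x"
    by (auto simp: letter_supp_def)
qed

section \<open>Lists: splitting filtered words, common prefixes, orbits in a finite set\<close>

text \<open>Both marked letters satisfy \<open>P\<close> and have equally many
  \<open>P\<close>-letters before them in the same list, so they occupy the same position.\<close>

lemma split_unique_by_filter:
  assumes "xs @ y # zs = xs' @ y' # zs'" "P y" "P y'"
    "length (filter P xs) = length (filter P xs')"
  shows "xs = xs'"
  using assms
proof (induction xs arbitrary: xs')
  case Nil
  then show ?case by (cases xs') (auto split: if_splits)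
next
  case (Cons a xs)
  then show ?case by (cases xs') (auto split: if_splits)
qed

lemma filter_eq_appendD:
  assumes "filter P x = a @ b"
  obtains p q where "x = p @ q" "filter P p = a" "filter P q = b"
  using assms
proof (induction x arbitrary: a thesis)
  case Nil
  then show ?case by simp
next
  case (Cons c x)
  show ?case
  proof (cases "P c \<and> a \<noteq> []")
    case True
    then obtain a' where a': "a = c # a'" "filter P x = a' @ b"
      using Cons.prems(2) by (cases a) auto
    from Cons.IH[OF _ a'(2)] obtain p q where "x = p @ q" "filter P p = a'" "filter P q = b" .
    then show ?thesis using True a' Cons.prems(1)[of "c # p" q] by simp
  next
    case False
    show ?thesis
    proof (cases "a = []")
      case True
      then show ?thesis using Cons.prems(1)[of "[]" "c # x"] Cons.prems(2) by simp
    next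
      case a: False
      then have "filter P x = a @ b" using False Cons.prems(2) by simp
      from Cons.IH[OF _ this] obtain p q where "x = p @ q" "filter P p = a" "filter P q = b" .
      then show ?thesis using a False Cons.prems(1)[of "c # p" q] by simp
    qed
  qed
qed

lemma filter_eq_append_ConsD:
  assumes "filter P x = a @ y # b"
  obtains x1 x2 where "x = x1 @ y # x2" "filter P x1 = a" "filter P x2 = b" "P y"
proof -
  obtain p q where pq: "x = p @ q" "filter P p = a" "filter P q = y # b"
    using filter_eq_appendD[OF assms] .
  then obtain us vs where "q = us @ y # vs" "\<forall>x\<in>set us. \<not> P x" "P y" "b = filter P vs"
    by (auto simp: filter_eq_Cons_iff)
  then show ?thesis using that[of "p @ us" vs] pq by (simp add: filter_empty_conv)
qed

text \<open>Allows a long word to be truncated: a common prefix that fits into \<open>a\<close> does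
  not see \<open>b\<close>.\<close>

lemma longest_common_prefix_append:
  "length (longest_common_prefix (a @ b) c) \<le> length a \<Longrightarrow>
    longest_common_prefix a c = longest_common_prefix (a @ b) c"
proof (induction a arbitrary: c)
  case (Cons x a) then show ?case by (cases c) auto
qed simp

lemma longest_common_prefix_drop:
  assumes "n = length (longest_common_prefix U V)"
  shows "U = longest_common_prefix U V @ drop n U" "V = longest_common_prefix U V @ drop n V"
    and "drop n U = [] \<or> drop n V = [] \<or> hd (drop n U) \<noteq> hd (drop n V)"
  unfolding assms
  by (induction U V rule: longest_common_prefix.induct) auto

text \<open>Used with \<open>a\<close> over a closed set of letters and \<open>z\<close> outside it,
  so that \<open>z\<close> is a barrier.\<close>

lemma prefix_append_Cons_notin:
  assumes "prefix a (b @ z # c)" "z \<notin> set a" shows "prefix a b"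
proof -
  have "prefix a (b @ [z]) \<or> prefix (b @ [z]) a"
    by (rule prefix_same_cases[OF assms(1)]) simp
  then have "prefix a b \<or> prefix (b @ [z]) a" by auto
  then show ?thesis using assms(2) by (auto simp: prefix_def)
qed

text \<open>Up to the first time \<open>P\<close> holds all states are distinct, since after a
  repetition the deterministic orbit would have reached \<open>P\<close> earlier.\<close>

lemma funpow_finite_state_bound:
  assumes "finite C" "\<And>t. s t \<in> C" "\<And>t. s (Suc t) = G (s t)" "P (s t)"
  shows "\<exists>t<card C. P (s t)"
proof -
  define t0 where "t0 = (LEAST t. P (s t))"
  have P0: "P (s t0)" unfolding t0_def using assms(4) by (rule LeastI)
  have least: "\<not> P (s t)" if "t < t0" for t
    using not_less_Least that unfolding t0_def by blast
  have shift: "s (i + n) = s (j + n)" if "s i = s j" for i j n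
    using that by (induction n) (simp_all add: assms(3))
  have "s i \<noteq> s j" if "i < j" "j \<le> t0" for i j
  proof
    assume "s i = s j"
    then have "s (i + (t0 - j)) = s t0" using shift[of i j "t0 - j"] that by simp
    moreover have "i + (t0 - j) < t0" using that by simp
    ultimately show False using least P0 by metis
  qed
  then have "inj_on s {..t0}"
    by (metis atMost_iff inj_onI linorder_neqE_nat)
  then have "card {..t0} \<le> card C"
    using assms(1,2) by (metis card_inj_on_le image_subsetI)
  then show ?thesis using P0 by (intro exI[of _ t0]) simp
qed

section \<open>Absorption modulo closed sets of letters\<close>

text \<open>Later \<open>h x\<close> is the reversed word of \<phi>(x). Then \<open>self\<close> is
  condition (1), \<open>inj\<close> and \<open>bounded_cancellation\<close> reflect that \<phi> is
  an automorphism, and \<open>leftmost_stable\<close> is the rightmost half of condition (5) for the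
  stratum of \<open>x\<close> itself.\<close>

locale positive_substitution =
  fixes A :: "'a set" and h :: "'a \<Rightarrow> 'a list"
  assumes fin: "finite A"
    and h_in: "x \<in> A \<Longrightarrow> set (h x) \<subseteq> A"
    and self: "x \<in> A \<Longrightarrow> x \<in> set (h x)"
    and inj: "set u \<subseteq> A \<Longrightarrow> set v \<subseteq> A \<Longrightarrow> ext h u = ext h v \<Longrightarrow> u = v"
    and bounded_cancellation:
      "\<exists>B. \<forall>u v w. set u \<subseteq> A \<longrightarrow> set v \<subseteq> A \<longrightarrow> (u = [] \<or> v = [] \<or> hd u \<noteq> hd v) \<longrightarrow>
         prefix w (ext h u) \<longrightarrow> prefix w (ext h v) \<longrightarrow> length w \<le> B"
    and leftmost_stable:
      "x \<in> A \<Longrightarrow> find (\<lambda>y. y \<in> letter_stratum h x) ((ext h ^^ Suc j) [x]) =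
                   find (\<lambda>y. y \<in> letter_stratum h x) (h x)"
begin

abbreviation img :: "nat \<Rightarrow> 'a list \<Rightarrow> 'a list" where
  "img k \<equiv> ext h ^^ k"

abbreviation proj :: "'a set \<Rightarrow> 'a list \<Rightarrow> 'a list" where
  "proj S \<equiv> filter (\<lambda>x. x \<notin> S)"

definition closed :: "'a set \<Rightarrow> bool" where
  "closed S \<longleftrightarrow> S \<subseteq> A \<and> (\<forall>x\<in>S. set (h x) \<subseteq> S)"

definition absorbs :: "'a list \<Rightarrow> 'a list \<Rightarrow> bool" where
  "absorbs u v \<longleftrightarrow> set u \<subseteq> A \<and> set v \<subseteq> A \<and> (\<exists>k. prefix (img k v) (img k u))"

lemma closed_A: "closed A"
  using h_in by (auto simp: closed_def)

lemma img_closed: "closed S \<Longrightarrow> set w \<subseteq> S \<Longrightarrow> set (img k w) \<subseteq> S"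
proof (induction k)
  case (Suc k)
  then show ?case by (simp add: closed_def set_ext) blast
qed simp

lemma img_A: "set w \<subseteq> A \<Longrightarrow> set (img k w) \<subseteq> A"
  using img_closed closed_A by blast

lemma img_self: "x \<in> A \<Longrightarrow> x \<in> set w \<Longrightarrow> x \<in> set (img k w)"
  using self by (induction k) (auto simp: set_ext)

lemma inj_img: "set u \<subseteq> A \<Longrightarrow> set v \<subseteq> A \<Longrightarrow> img k u = img k v \<Longrightarrow> u = v"
  by (induction k) (simp_all add: inj img_A)

lemma prefix_img_mono:
  assumes "prefix (img k v) (img k u)" "k \<le> l" shows "prefix (img l v) (img l u)"
  using prefix_ext_pow[OF assms(1), of "l - k" h] assms(2)
  by (simp flip: ext_pow_add)

lemma absorbs_img:
  assumes "absorbs u v" shows "absorbs (img t u) (img t v)"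
proof -
  obtain k where "prefix (img k v) (img k u)" using assms by (auto simp: absorbs_def)
  then have "prefix (img (k + t) v) (img (k + t) u)" using prefix_img_mono by simp
  then show ?thesis using assms img_A by (auto simp: absorbs_def ext_pow_add)
qed

lemma absorbs_cancel: "absorbs (w @ u) (w @ v) \<Longrightarrow> absorbs u v"
  by (auto simp: absorbs_def)

lemma proj_ext: "closed S \<Longrightarrow> proj S (ext h w) = proj S (ext h (proj S w))"
  by (induction w) (auto simp: closed_def filter_empty_conv)

lemma proj_img:
  assumes "closed S" "proj S u = proj S v"
  shows "proj S (img k u) = proj S (img k v)"
  using assms by (induction k) (simp_all, metis proj_ext)

lemma first_outside:
  assumes "\<not> set w \<subseteq> S"
  obtains P y R where "w = P @ y # R" "set P \<subseteq> S" "y \<notin> S"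
proof -
  have "\<exists>x\<in>set w. x \<notin> S" using assms by auto
  from split_list_first_propE[OF this] that show thesis
    by (metis subsetI)
qed

text \<open>Letters of a closed set \<open>S\<close> sitting between letters outside \<open>S\<close> never move past them,
  so an eventual cancellation that is visible modulo \<open>S\<close> is already a genuine one.\<close>

lemma absorbs_match:
  assumes ab: "absorbs (u1 @ y # u2) (v1 @ y # v2)" and S: "closed S" "y \<notin> S"
    and pr: "proj S u1 = proj S v1"
  shows "u1 = v1"
proof -
  have sA: "set u1 \<subseteq> A" "set v1 \<subseteq> A" "y \<in> A" using ab by (auto simp: absorbs_def)
  obtain k where k: "prefix (img k (v1 @ y # v2)) (img k (u1 @ y # u2))"
    using ab by (auto simp: absorbs_def)
  have "y \<in> set (img k [y])" using img_self sA by simp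
  then have "\<not> set (img k [y]) \<subseteq> S" using S by auto
  then obtain P z R where z: "img k [y] = P @ z # R" "z \<notin> S"
    using first_outside by metis
  from k obtain Z where "img k (u1 @ y # u2) = img k (v1 @ y # v2) @ Z"
    by (auto simp: prefix_def)
  \<comment> \<open>On each side \<open>z\<close> is the first letter outside \<open>S\<close>
    produced by \<open>y\<close>. By \<open>pr\<close> equally many letters outside \<open>S\<close>
    precede it, so both positions coincide.\<close>
  then have eq: "(img k u1 @ P) @ z # (R @ img k u2) = (img k v1 @ P) @ z # (R @ img k v2 @ Z)"
    by (simp add: ext_pow_Cons[of k h y u2] ext_pow_Cons[of k h y v2] z)
  have "img k u1 @ P = img k v1 @ P"
    using split_unique_by_filter[OF eq, of "\<lambda>x. x \<notin> S"] z proj_img[OF S(1) pr, of k] by simp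
  then show ?thesis using inj_img sA by simp
qed

text \<open>Cut both words after the last letter of \<open>g\<close>; \<open>absorbs_match\<close>
  makes the parts before that letter equal.\<close>

lemma absorbs_split:
  assumes ab: "absorbs u v" and S: "closed S"
    and pr: "proj S u = g @ U" "proj S v = g @ V"
  obtains w u' v' where "u = w @ u'" "v = w @ v'" "proj S w = g" "proj S u' = U" "proj S v' = V"
proof (cases g rule: rev_cases)
  case Nil
  then show ?thesis using that[of "[]" u v] pr by simp
next
  case (snoc a y)
  obtain u1 u2 where u: "u = u1 @ y # u2" "proj S u1 = a" "proj S u2 = U" "y \<notin> S"
    using filter_eq_append_ConsD[of "\<lambda>x. x \<notin> S" u a y U] pr(1) unfolding snoc by auto
  obtain v1 v2 where v: "v = v1 @ y # v2" "proj S v1 = a" "proj S v2 = V"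
    using filter_eq_append_ConsD[of "\<lambda>x. x \<notin> S" v a y V] pr(2) unfolding snoc append_assoc by simp blast
  have "u1 = v1" using absorbs_match[of u1 y u2 v1 v2 S] ab S u v by simp
  then show ?thesis using that[of "u1 @ [y]" u2 v2] u v snoc by simp
qed

section \<open>The first letter outside a closed set\<close>

definition first_letter :: "'a set \<Rightarrow> 'a \<Rightarrow> 'a" where
  "first_letter S z = hd (proj S (h z))"

lemma first_letter_split:
  assumes "z \<in> A" "z \<notin> S"
  obtains P R where "h z = P @ first_letter S z # R" "set P \<subseteq> S" "first_letter S z \<in> A - S"
proof -
  have "\<not> set (h z) \<subseteq> S" using self assms by auto
  then obtain P y R where y: "h z = P @ y # R" "set P \<subseteq> S" "y \<notin> S"
    using first_outside by metis
  then have "first_letter S z = y"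
    by (subst first_letter_def) (auto simp: filter_empty_conv subset_iff)
  then show ?thesis using that[of P R] y h_in[OF assms(1)] by auto
qed

text \<open>Letters in front of the first one outside \<open>S\<close> stay in the closed set
  \<open>S\<close>, so that first letter evolves on its own under
  \<open>first_letter S\<close>.\<close>

lemma first_letter_img:
  assumes "closed S" "z \<in> A" "z \<notin> S"
  shows "\<exists>P R. img k [z] = P @ (first_letter S ^^ k) z # R \<and> set P \<subseteq> S \<and>
    (first_letter S ^^ k) z \<in> A - S"
proof (induction k)
  case 0
  then show ?case using assms by (intro exI[of _ "[]"]) simp
next
  case (Suc k)
  then obtain P R where PR: "img k [z] = P @ (first_letter S ^^ k) z # R" "set P \<subseteq> S"
    "(first_letter S ^^ k) z \<in> A - S" by blast
  from PR(3) obtain P' R' where P': "h ((first_letter S ^^ k) z) = P' @ first_letter S ((first_letter S ^^ k) z) # R'"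
    "set P' \<subseteq> S" "first_letter S ((first_letter S ^^ k) z) \<in> A - S"
    by (metis DiffE first_letter_split)
  have "set (ext h P) \<subseteq> S" using img_closed[OF assms(1) PR(2), of 1] by simp
  then show ?case using PR P'
    by (intro exI[of _ "ext h P @ P'"] exI[of _ "R' @ ext h R"]) simp
qed

lemma letter_supp_closed: "closed S \<Longrightarrow> x \<in> S \<Longrightarrow> letter_supp h x \<subseteq> S"
  unfolding letter_supp_def using img_closed[of S "[x]"] by auto

text \<open>Being on a cycle puts \<open>z\<close> and \<open>first_letter S z\<close> into one
  stratum. That stratum misses \<open>S\<close>, as otherwise \<open>z\<close> would lie in
  \<open>S\<close>. Hence the first letters outside \<open>S\<close> of both images of
  \<open>z\<close> are also their first letters from the stratum, and \<open>leftmost_stable\<close>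
  identifies them.\<close>

lemma first_letter_periodic:
  assumes S: "closed S" and z: "z \<in> A" "z \<notin> S" and per: "(first_letter S ^^ Suc j) z = z"
  shows "first_letter S z = z"
proof -
  let ?f = "first_letter S"
  obtain P R where 1: "h z = P @ ?f z # R" "set P \<subseteq> S" "?f z \<in> A - S"
    using first_letter_split z by metis
  obtain P' R' where 2: "img (Suc j) [z] = P' @ z # R'" "set P' \<subseteq> S"
    using first_letter_img[OF S z, of "Suc j"] per by metis
  obtain P'' R'' where 3: "img j [?f z] = P'' @ (?f ^^ j) (?f z) # R''"
    using first_letter_img[OF S, of "?f z" j] 1 by blast
  have fj: "(?f ^^ j) (?f z) = z" using per by (simp add: funpow_swap1)
  have "z \<in> letter_supp h (?f z)"
    using 3 fj by (auto simp: letter_supp_def intro!: exI[of _ j])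
  moreover have "?f z \<in> letter_supp h z"
    using 1 by (auto simp: letter_supp_def intro!: exI[of _ 1])
  ultimately have str: "?f z \<in> letter_stratum h z" "z \<in> letter_stratum h z"
    using letter_supp_trans letter_supp_refl by (fastforce simp: letter_stratum_def)+
  have notS: "y \<notin> letter_stratum h z" if "y \<in> S" for y
    using letter_supp_closed[OF S that] letter_supp_refl[of z h] z
    by (auto simp: letter_stratum_def)
  have find: "find (\<lambda>y. y \<in> letter_stratum h z) (Q @ y # Q') = Some y"
    if "set Q \<subseteq> S" "y \<in> letter_stratum h z" for Q y Q'
    using that notS by (induction Q) auto
  show ?thesis
    using leftmost_stable[OF z(1), of j] find[OF 1(2) str(1)] find[OF 2(2) str(2)]
    unfolding 2(1) 1(1) by (metis option.inject)
qed

text \<open>In the finite set \<open>A\<close> every orbit reaches a cycle, and cycles are fixed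
  points by \<open>first_letter_periodic\<close>. A maximum over the letters makes \<open>m\<close>
  uniform.\<close>

lemma first_letter_eventually_fixed:
  assumes S: "closed S"
  obtains m where "\<And>z. z \<in> A \<Longrightarrow> z \<notin> S \<Longrightarrow>
    first_letter S ((first_letter S ^^ m) z) = (first_letter S ^^ m) z"
proof -
  let ?f = "first_letter S"
  have mem: "(?f ^^ k) z \<in> A - S" if "z \<in> A - S" for z k
    using first_letter_img[OF S, of z k] that by auto
  have "\<exists>m. ?f ((?f ^^ m) z) = (?f ^^ m) z" if z: "z \<in> A - S" for z
  proof -
    have "range (\<lambda>k. (?f ^^ k) z) \<subseteq> A" using mem[OF z] by auto
    then have "\<not> inj (\<lambda>k. (?f ^^ k) z)"
      using fin by (meson finite_subset infinite_UNIV_nat finite_imageD)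
    then obtain i j where "i < j" "(?f ^^ i) z = (?f ^^ j) z"
      unfolding inj_def by (metis linorder_neqE_nat)
    then have "(?f ^^ Suc (j - i - 1)) ((?f ^^ i) z) = (?f ^^ i) z"
      by (metis Suc_diff_1 add.commute add_diff_inverse_nat comp_apply diff_diff_left funpow_add
          less_imp_not_less plus_1_eq_Suc zero_less_diff)
    then show ?thesis using first_letter_periodic[OF S] mem[OF z] by blast
  qed
  then obtain m where m: "\<And>z. z \<in> A - S \<Longrightarrow> ?f ((?f ^^ m z) z) = (?f ^^ m z) z" by metis
  have later: "?f ((?f ^^ n) z) = (?f ^^ n) z" if "z \<in> A - S" "m z \<le> n" for z n
  proof -
    have "(?f ^^ (i + m z)) z = (?f ^^ m z) z" for i
      using m[OF that(1)] by (induction i) simp_all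
    from this[of "n - m z"] m[OF that(1)] that(2) show ?thesis by simp
  qed
  have "m z \<le> Max (m ` A)" if "z \<in> A" for z using fin that by simp
  then show ?thesis using that[of "Max (m ` A)"] later by simp
qed

text \<open>From time \<open>m\<close> on, the front evolves simply: each step applies
  \<open>h\<close> to the word before \<open>z\<close> and appends the word \<open>p\<close> over
  \<open>S\<close> to it.\<close>

lemma front_normal_form:
  assumes S: "closed S"
  obtains m where "\<And>u. set u \<subseteq> A \<Longrightarrow> \<not> set u \<subseteq> S \<Longrightarrow>
    \<exists>d z p s u'. img m u = d @ z # u' \<and> h z = p @ z # s \<and> set d \<subseteq> S \<and> set p \<subseteq> S \<and> z \<in> A - S"
proof -
  obtain m where m: "\<And>z. z \<in> A \<Longrightarrow> z \<notin> S \<Longrightarrow>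
    first_letter S ((first_letter S ^^ m) z) = (first_letter S ^^ m) z"
    using first_letter_eventually_fixed[OF S] by metis
  have "\<exists>d z p s u'. img m u = d @ z # u' \<and> h z = p @ z # s \<and> set d \<subseteq> S \<and> set p \<subseteq> S \<and> z \<in> A - S"
    if u: "set u \<subseteq> A" "\<not> set u \<subseteq> S" for u
  proof -
    from u obtain P y R where y: "u = P @ y # R" "set P \<subseteq> S" "y \<notin> S" using first_outside by metis
    then have yA: "y \<in> A" using u by auto
    let ?z = "(first_letter S ^^ m) y"
    obtain P' R' where P': "img m [y] = P' @ ?z # R'" "set P' \<subseteq> S" "?z \<in> A - S"
      using first_letter_img[OF S yA y(3), of m] by blast
    from P'(3) obtain p s where "h ?z = p @ first_letter S ?z # s" "set p \<subseteq> S"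
      by (metis DiffE first_letter_split)
    then show ?thesis using P' y m[OF yA y(3)] img_closed[OF S y(2), of m]
      by (intro exI[of _ "img m P @ P'"] exI[of _ ?z] exI[of _ p] exI[of _ s] exI[of _ "R' @ img m R"])
        (simp add: ext_pow_Cons[of m h y R])
  qed
  then show ?thesis using that by blast
qed

lemma length_ext: "set w \<subseteq> A \<Longrightarrow> length w \<le> length (ext h w)"
proof (induction w)
  case (Cons x w)
  have "h x \<noteq> []" using self[of x] Cons.prems by auto
  then have "Suc 0 \<le> length (h x)" by (cases "h x") auto
  then show ?case using Cons by simp
qed simp

text \<open>The letter \<open>y\<close> survives in every image; replacing it by \<open>h y\<close>
  adds a letter, and nothing else shrinks.\<close>

lemma length_img_nonconstant:
  assumes y: "y \<in> A" "h y \<noteq> [y]"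
  shows "Suc k \<le> length (img k [y])"
proof (induction k)
  case (Suc k)
  have "y \<in> set (img k [y])" using img_self y by simp
  then obtain a b where ab: "img k [y] = a @ y # b" by (meson split_list)
  have "set (img k [y]) \<subseteq> A" using img_A y by simp
  then have "length a \<le> length (ext h a)" "length b \<le> length (ext h b)"
    using length_ext by (simp_all add: ab)
  moreover have "2 \<le> length (h y)"
    using self[OF y(1)] y(2) by (cases "h y"; cases "tl (h y)") auto
  ultimately show ?case using Suc by (simp add: ab)
qed simp

section \<open>Letters fixed modulo a closed set\<close>

text \<open>The set \<open>S'\<close> of the overview. Its members outside \<open>S\<close> are the
  letters that \<open>h\<close> fixes modulo \<open>S\<close>; a closed \<open>S\<close> is
  contained in it.\<close>

definition para :: "'a set \<Rightarrow> 'a set" where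
  "para S = {x \<in> A. \<exists>l q. h x = l @ x # q \<and> set l \<subseteq> S \<and> set q \<subseteq> S}"

lemma para_supset: "closed S \<Longrightarrow> S \<subseteq> para S"
proof
  fix x assume S: "closed S" and x: "x \<in> S"
  then have xA: "x \<in> A" "set (h x) \<subseteq> S" by (auto simp: closed_def)
  then obtain l q where "h x = l @ x # q" using self split_list by metis
  then show "x \<in> para S" using xA by (auto simp: para_def)
qed

lemma closed_para: "closed S \<Longrightarrow> closed (para S)"
  unfolding closed_def[of "para S"]
proof (intro conjI ballI)
  fix x assume S: "closed S" and x: "x \<in> para S"
  then obtain l q where "h x = l @ x # q" "set l \<subseteq> S" "set q \<subseteq> S" by (auto simp: para_def)
  then show "set (h x) \<subseteq> para S" using x para_supset[OF S] by auto
qed (simp add: para_def)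

lemma proj_subset: "set w \<subseteq> S \<Longrightarrow> proj S w = []"
  by (auto simp: filter_empty_conv)

lemma proj_ext_para:
  assumes S: "closed S" and w: "set w \<subseteq> para S"
  shows "proj S (ext h w) = proj S w"
  using w
proof (induction w)
  case (Cons y w)
  have "proj S (h y) = proj S [y]"
  proof (cases "y \<in> S")
    case True
    then show ?thesis using S by (simp add: closed_def proj_subset)
  next
    case False
    then show ?thesis using Cons.prems by (auto simp: para_def proj_subset)
  qed
  then show ?case using Cons by simp
qed simp

lemma proj_img_para:
  assumes S: "closed S" and w: "set w \<subseteq> para S"
  shows "proj S (img k w) = proj S w"
  by (induction k) (simp_all add: proj_ext_para[OF S img_closed[OF closed_para[OF S] w]])

lemma img_para_letter:
  assumes S: "closed S" and y: "y \<in> para S"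
  shows "\<exists>L R. img k [y] = L @ y # R \<and> set L \<subseteq> S \<and> set R \<subseteq> S"
proof (induction k)
  case 0
  show ?case by (intro exI[of _ "[]"]) simp
next
  case (Suc k)
  then obtain L R where LR: "img k [y] = L @ y # R" "set L \<subseteq> S" "set R \<subseteq> S" by blast
  obtain l q where lq: "h y = l @ y # q" "set l \<subseteq> S" "set q \<subseteq> S"
    using y by (auto simp: para_def)
  show ?case using LR lq img_closed[OF S, of L 1] img_closed[OF S, of R 1]
    by (intro exI[of _ "ext h L @ l"] exI[of _ "q @ ext h R"]) simp
qed

text \<open>A fixed front letter emits one image of \<open>p\<close> per unit of time. Two consecutive
  emissions differ in age by one, hence the gap between corresponding letters is bounded, whereas
  the gap between the letters of \<open>r\<close> they would have to cancel grows with time.\<close>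

lemma absorb_para_bounded:
  assumes S: "closed S" and const: "\<And>x. x \<in> A \<Longrightarrow> h x = [x] \<Longrightarrow> x \<in> S"
  obtains T where "\<And>u r. absorbs u r \<Longrightarrow> set r \<subseteq> para S \<Longrightarrow>
    prefix (proj S (img T r)) (proj S (img T u))"
proof -
  note S' = closed_para[OF S]
  obtain m where m: "\<And>u. set u \<subseteq> A \<Longrightarrow> \<not> set u \<subseteq> para S \<Longrightarrow>
    \<exists>d z p s u'. img m u = d @ z # u' \<and> h z = p @ z # s \<and> set d \<subseteq> para S \<and> set p \<subseteq> para S \<and>
      z \<in> A - para S"
    using front_normal_form[OF S'] by metis
  \<comment> \<open>\<open>C\<close> bounds, uniformly in \<open>z\<close>, the gap between
    corresponding letters of two consecutive emissions. \<open>J\<close> is two steps later, so that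
    \<open>W J\<close> extends \<open>W C\<close> by two emissions.\<close>
  define C where "C = (\<Sum>z\<in>A. length (h z) + length (ext h (h z)))"
  define J where "J = Suc (Suc C)"
  have "prefix (proj S (img (J + m) r)) (proj S (img (J + m) u))"
    if ab: "absorbs u r" and r: "set r \<subseteq> para S" for u r
  proof (cases "set u \<subseteq> para S")
    case True
    obtain k where "prefix (img k r) (img k u)" using ab by (auto simp: absorbs_def)
    then have "prefix (proj S (img k r)) (proj S (img k u))" by (auto simp: prefix_def)
    then show ?thesis using proj_img_para[OF S] r True by simp
  next
    case False
    have "set u \<subseteq> A" using ab by (simp add: absorbs_def)
    then obtain d z p s u' where u1: "img m u = d @ z # u'" and z: "h z = p @ z # s" "z \<in> A" "z \<notin> para S"
      and d: "set d \<subseteq> para S" and p: "set p \<subseteq> para S"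
      using m[OF _ False] by auto
    define r1 where "r1 = img m r"
    have r1: "set r1 \<subseteq> para S" using img_closed[OF S' r] by (simp add: r1_def)
    have ab1: "absorbs (d @ z # u') r1" using absorbs_img[OF ab, of m] by (simp add: u1 r1_def)
    \<comment> \<open>The word over \<open>para S\<close> standing before \<open>z\<close> at time
      \<open>t\<close>.\<close>
    define D where "D t = ((\<lambda>x. ext h x @ p) ^^ t) d" for t
    have D_Suc: "D (Suc t) = ext h (D t) @ p" for t by (simp add: D_def)
    have D_in: "set (D t) \<subseteq> para S" for t
    proof (induction t)
      case (Suc t)
      then show ?case using img_closed[OF S', of "D t" 1] p by (simp add: D_Suc)
    qed (simp add: D_def d)
    have D_img: "\<exists>w. img t (d @ z # u') = D t @ z # w" for t
    proof (induction t)
      case 0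
      show ?case by (simp add: D_def)
    next
      case (Suc t)
      then obtain w where w: "img t (d @ z # u') = D t @ z # w" by blast
      show ?case by (simp only: funpow.simps comp_apply w) (simp add: z D_Suc)
    qed
    \<comment> \<open>This is \<open>D t\<close> modulo \<open>S\<close>: old letters of
      \<open>para S\<close> no longer change there, and only copies of \<open>p\<close>
      accumulate.\<close>
    define W where "W t = ((\<lambda>x. x @ proj S p) ^^ t) (proj S d)" for t
    have W_Suc: "W (Suc t) = W t @ proj S p" for t by (simp add: W_def)
    have D_proj: "proj S (D t) = W t" for t
    proof (induction t)
      case (Suc t)
      then show ?case by (simp add: D_Suc W_Suc proj_ext_para[OF S D_in])
    qed (simp add: D_def W_def)
    have W_mono: "prefix (W i) (W j)" if "i \<le> j" for i j
      using that by (induction j rule: dec_induct) (simp_all add: W_Suc prefix_prefix)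
    obtain t where "prefix (img t r1) (img t (d @ z # u'))"
      using ab1 by (auto simp: absorbs_def)
    moreover obtain w where "img t (d @ z # u') = D t @ z # w" using D_img by blast
    ultimately have "prefix (proj S (img t r1)) (proj S (D t @ z # w))"
      by (metis filter_mono_prefix)
    then have "prefix (proj S r1) (W t @ z # proj S w)"
      using z para_supset[OF S] by (simp add: proj_img_para[OF S r1] D_proj split: if_splits) blast
    then have pre: "prefix (proj S r1) (W t)"
      using prefix_append_Cons_notin[of "proj S r1"] r1 z by (metis filter_is_subset subset_iff)
    \<comment> \<open>If time \<open>J\<close> did not suffice, \<open>r1\<close> modulo
      \<open>S\<close> would begin with \<open>W J\<close> and hence have to cancel two successive
      emissions after \<open>W C\<close>.\<close>
    have "prefix (proj S r1) (W J)"
    proof (rule ccontr)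
      assume neg: "\<not> prefix (proj S r1) (W J)"
      then have "J < t" using pre W_mono[of t J] prefix_order.order_trans by (meson not_le_imp_less)
      then have "prefix (W J) (proj S r1)"
        using prefix_same_cases[OF pre W_mono[of J t]] neg by auto
      then obtain e where e: "proj S r1 = W J @ e" by (auto simp: prefix_def)
      have "proj S p \<noteq> []"
      proof
        assume "proj S p = []"
        then have "W i = proj S d" for i by (induction i) (simp_all add: W_Suc, simp add: W_def)
        then have "W J = W t" by metis
        then show False using neg pre by simp
      qed
      then have "\<not> set p \<subseteq> S" using proj_subset by blast
      \<comment> \<open>The first letter \<open>y\<close> of \<open>p\<close> outside
        \<open>S\<close> serves as a marker in both emissions; it is nonconstant by
        \<open>const\<close>.\<close>
      then obtain a y b where aby: "p = a @ y # b" "set a \<subseteq> S" "y \<notin> S"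
        using first_outside by metis
      have y: "y \<in> para S" "y \<in> A" "h y \<noteq> [y]"
        using p aby const by (auto simp: para_def)
      have W2: "W J = W C @ proj S p @ proj S p"
        by (simp add: J_def W_Suc)
      have "proj S r1 = W C @ y # (proj S b @ y # (proj S b @ e))"
        using aby by (simp add: e W2 proj_subset)
      then obtain r' rr where r': "r1 = r' @ y # rr" "proj S r' = W C"
        and rr: "proj S rr = proj S b @ y # (proj S b @ e)" "y \<notin> S"
        by (rule filter_eq_append_ConsD)
      from rr(1) obtain r2 r3 where r2: "rr = r2 @ y # r3" "proj S r2 = proj S b"
        "proj S r3 = proj S b @ e" "y \<notin> S"
        by (rule filter_eq_append_ConsD)
      obtain l q where lq: "h y = l @ y # q" "set l \<subseteq> S" "set q \<subseteq> S"
        using y by (auto simp: para_def)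
      obtain L R where LR: "img J [y] = L @ y # R" "set L \<subseteq> S" "set R \<subseteq> S"
        using img_para_letter[OF S y(1)] by blast
      obtain w where w: "img J (d @ z # u') = D J @ z # w" using D_img by blast
      define X where "X = ext h (ext h (D C)) @ ext h a @ l"
      \<comment> \<open>At time \<open>J\<close> these markers come from emissions of age one and
        zero, so their gap \<open>q @ ext h b @ a\<close> has length independent of
        \<open>J\<close>.\<close>
      have uJ: "img J (d @ z # u') = X @ y # q @ ext h b @ a @ y # (b @ z # w)"
        unfolding w unfolding J_def by (simp add: D_Suc aby lq X_def)
      \<comment> \<open>In \<open>r1\<close> both markers were present from the start and have grown
        for \<open>J\<close> steps; the gap now contains \<open>R\<close> and \<open>L\<close>,
        together at least \<open>J\<close> letters.\<close>
      have rJ: "img J r1 = (img J r' @ L) @ y # R @ img J r2 @ L @ y # (R @ img J r3)"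
        unfolding r'(1) r2(1)
        by (simp only: ext_pow_append ext_pow_Cons[of J h y r3] ext_pow_Cons[of J h y "r2 @ y # r3"]
            LR(1) append.simps append_assoc)
      have abJ: "absorbs (img J (d @ z # u')) (img J r1)" using absorbs_img[OF ab1] .
      have ea: "proj S (ext h a) = []" using img_closed[OF S aby(2), of 1] by (simp add: proj_subset)
      have "proj S (ext h (ext h (D C))) = W C"
        using proj_img_para[OF S D_in[of C], of 2] by (simp add: D_proj numeral_2_eq_2)
      then have pX: "proj S X = W C" using ea lq by (simp add: X_def proj_subset)
      have "set r' \<subseteq> para S" "set r2 \<subseteq> para S" using r1 r' r2 by auto
      then have pr: "proj S (img J r') = W C" "proj S (img J r2) = proj S b"
        using proj_img_para[OF S] r' r2 by simp_all
      have pb: "proj S (ext h b) = proj S b" using proj_ext_para[OF S] p aby by simp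
      have eq1: "X = img J r' @ L"
        by (rule absorbs_match[OF abJ[unfolded uJ rJ] S aby(3)]) (simp add: pX pr LR proj_subset)
      \<comment> \<open>With the first markers matched by \<open>eq1\<close>, matching the second
        ones forces equal gaps, although one is at most \<open>C\<close> and the other at least
        \<open>J\<close>.\<close>
      have "X @ y # q @ ext h b @ a = (img J r' @ L) @ y # R @ img J r2 @ L"
      proof (rule absorbs_match[OF _ S aby(3)])
        show "absorbs ((X @ y # q @ ext h b @ a) @ y # (b @ z # w))
          (((img J r' @ L) @ y # R @ img J r2 @ L) @ y # (R @ img J r3))"
          using abJ unfolding uJ rJ by simp
      qed (simp add: pX pr pb LR lq aby proj_subset)
      then have "length (q @ ext h b @ a) = length (R @ img J r2 @ L)" by (simp add: eq1)
      moreover have "Suc J \<le> length L + Suc (length R)"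
        using length_img_nonconstant[OF y(2,3), of J] by (simp add: LR)
      moreover have "length (h z) + length (ext h (h z)) \<le> C"
        unfolding C_def using z fin by (intro member_le_sum) auto
      ultimately show False by (simp add: z aby lq J_def)
    qed
    moreover obtain w where "img J (d @ z # u') = D J @ z # w" using D_img by blast
    then have "proj S (img (J + m) u) = W J @ proj S (z # w)"
      by (simp only: ext_pow_add u1 filter_append D_proj)
    ultimately show ?thesis
      using proj_img_para[OF S r1, of J] by (simp add: ext_pow_add r1_def)
  qed
  then show ?thesis using that by blast
qed

section \<open>The substitution induced modulo a closed set\<close>

definition quotient_ext :: "'a set \<Rightarrow> 'a list \<Rightarrow> 'a list" where
  "quotient_ext S w = proj S (ext h w)"

text \<open>Defined through lifts rather than through prefixes in the quotient: an absorbing lift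
  allows \<open>absorbs_split\<close> to turn common prefixes modulo \<open>S\<close> into genuine
  ones.\<close>

definition quotient_absorbs :: "'a set \<Rightarrow> 'a list \<Rightarrow> 'a list \<Rightarrow> bool" where
  "quotient_absorbs S U V \<longleftrightarrow> (\<exists>u v. absorbs u v \<and> U = proj S u \<and> V = proj S v)"

lemma quotient_ext_append: "quotient_ext S (u @ v) = quotient_ext S u @ quotient_ext S v"
  by (simp add: quotient_ext_def)

lemma quotient_ext_Nil [simp]: "quotient_ext S [] = []"
  by (simp add: quotient_ext_def)

lemma quotient_ext_proj: "closed S \<Longrightarrow> quotient_ext S (proj S w) = proj S (ext h w)"
  by (simp add: quotient_ext_def flip: proj_ext)

lemma quotient_ext_pow_proj: "closed S \<Longrightarrow> (quotient_ext S ^^ k) (proj S w) = proj S (img k w)"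
  by (induction k) (simp_all add: quotient_ext_proj)

lemma prefix_quotient_ext_pow:
  "prefix v u \<Longrightarrow> prefix ((quotient_ext S ^^ k) v) ((quotient_ext S ^^ k) u)"
  by (induction k) (auto simp: prefix_def quotient_ext_append)

lemma quotient_absorbs_ext:
  assumes "closed S" "quotient_absorbs S U V"
  shows "quotient_absorbs S (quotient_ext S U) (quotient_ext S V)"
proof -
  obtain u v where "absorbs u v" "U = proj S u" "V = proj S v"
    using assms(2) by (auto simp: quotient_absorbs_def)
  then show ?thesis
    using absorbs_img[of u v 1] quotient_ext_proj[OF assms(1)] by (auto simp: quotient_absorbs_def)
qed

lemma quotient_absorbs_cancel:
  assumes "closed S" "quotient_absorbs S (g @ U) (g @ V)" shows "quotient_absorbs S U V"
proof -
  obtain u v where uv: "absorbs u v" "proj S u = g @ U" "proj S v = g @ V"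
    using assms(2) by (auto simp: quotient_absorbs_def)
  obtain w u' v' where "u = w @ u'" "v = w @ v'" "proj S u' = U" "proj S v' = V"
    using absorbs_split[OF uv(1) assms(1) uv(2,3)] .
  then show ?thesis using absorbs_cancel uv(1) unfolding quotient_absorbs_def by metis
qed

lemma quotient_absorbs_eventually:
  assumes "closed S" "quotient_absorbs S U V"
  shows "\<exists>k. prefix ((quotient_ext S ^^ k) V) ((quotient_ext S ^^ k) U)"
proof -
  obtain u v where uv: "absorbs u v" "U = proj S u" "V = proj S v"
    using assms(2) by (auto simp: quotient_absorbs_def)
  then obtain k where "prefix (img k v) (img k u)" by (auto simp: absorbs_def)
  then have "prefix (proj S (img k v)) (proj S (img k u))" by (rule filter_mono_prefix)
  then show ?thesis using uv quotient_ext_pow_proj[OF assms(1)] by metis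
qed

lemma quotient_absorbs_subset:
  "quotient_absorbs S U V \<Longrightarrow> set U \<subseteq> A - S \<and> set V \<subseteq> A - S"
  by (auto simp: quotient_absorbs_def absorbs_def)

text \<open>Lift \<open>w\<close> to a genuine common prefix \<open>x\<close> of the images of
  \<open>u\<close> and \<open>v\<close>. The common prefix \<open>g\<close> of \<open>u\<close> and
  \<open>v\<close> lies over \<open>S\<close>, so its image is invisible modulo \<open>S\<close>;
  the rest of \<open>x\<close> is bounded by cancellation between the words left after
  \<open>g\<close>.\<close>

lemma quotient_bounded_cancellation:
  assumes S: "closed S"
  obtains B where "\<And>U V w. quotient_absorbs S U V \<Longrightarrow> U = [] \<or> V = [] \<or> hd U \<noteq> hd V \<Longrightarrow>
    prefix w (quotient_ext S U) \<Longrightarrow> prefix w (quotient_ext S V) \<Longrightarrow> length w \<le> B"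
proof -
  obtain B where B: "\<And>u v w. set u \<subseteq> A \<Longrightarrow> set v \<subseteq> A \<Longrightarrow> u = [] \<or> v = [] \<or> hd u \<noteq> hd v \<Longrightarrow>
      prefix w (ext h u) \<Longrightarrow> prefix w (ext h v) \<Longrightarrow> length w \<le> B"
    using bounded_cancellation by metis
  have "length w \<le> B"
    if q: "quotient_absorbs S U V" "U = [] \<or> V = [] \<or> hd U \<noteq> hd V"
      "prefix w (quotient_ext S U)" "prefix w (quotient_ext S V)" for U V w
  proof -
    obtain u v where uv: "absorbs u v" "U = proj S u" "V = proj S v"
      using q(1) by (auto simp: quotient_absorbs_def)
    have uvA: "set u \<subseteq> A" "set v \<subseteq> A" using uv by (simp_all add: absorbs_def)
    define n where "n = length (longest_common_prefix u v)"
    define g where "g = longest_common_prefix u v"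
    note lcp = longest_common_prefix_drop[OF n_def, folded g_def]
    have "proj S u = proj S g @ proj S (drop n u)" "proj S v = proj S g @ proj S (drop n v)"
      using lcp(1,2) by (metis filter_append)+
    then have "proj S g = []" using q(2) uv(2,3) by (cases "proj S g") auto
    then have "set g \<subseteq> S" by (auto simp: filter_empty_conv)
    then have eg: "set (ext h g) \<subseteq> S" using img_closed[OF S, of g 1] by simp
    obtain a b where "proj S (ext h u) = w @ a" "proj S (ext h v) = w @ b"
      using q(3,4) uv quotient_ext_proj[OF S] by (auto simp: prefix_def)
    then obtain x u' v' where x: "ext h u = x @ u'" "ext h v = x @ v'" "proj S x = w"
      using absorbs_split[OF _ S, of "ext h u" "ext h v" w a b] absorbs_img[OF uv(1), of 1]
      by simp metis
    have eu: "ext h u = ext h g @ ext h (drop n u)" "ext h v = ext h g @ ext h (drop n v)"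
      using lcp(1,2) ext_append by metis+
    show ?thesis
    proof (cases "prefix x (ext h g)")
      case True
      then have "set x \<subseteq> S" using eg set_mono_prefix by blast
      then show ?thesis using x(3) proj_subset by auto
    next
      case False
      then obtain y where y: "x = ext h g @ y"
        using prefix_same_cases[of x "ext h u" "ext h g"] x(1) eu(1) by (metis prefixE prefixI)
      have "prefix y (ext h (drop n u))" "prefix y (ext h (drop n v))"
        using x(1,2) y eu by auto
      moreover have "set (drop n u) \<subseteq> A" "set (drop n v) \<subseteq> A"
        using uvA set_drop_subset by fast+
      ultimately have "length y \<le> B" using B lcp(3) by blast
      moreover have "w = proj S y" using x(3) y eg by (simp add: proj_subset)
      ultimately show ?thesis using length_filter_le order_trans by blast
    qed
  qed
  then show ?thesis using that by blast
qed

text \<open>If no letter outside \<open>S\<close> is fixed modulo \<open>S\<close>, then modulo \<open>S\<close> every word at least doubles in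
  length, so by bounded cancellation only prefixes of bounded length matter and the
  cancellation process is a finite state machine.\<close>

lemma absorb_expanding_bounded:
  assumes S: "closed S" and exp: "para S = S"
  obtains T where "\<And>u v. absorbs u v \<Longrightarrow> prefix (proj S (img T v)) (proj S (img T u))"
proof -
  let ?q = "quotient_ext S" and ?E = "quotient_absorbs S"
  obtain B where B: "\<And>U V w. ?E U V \<Longrightarrow> U = [] \<or> V = [] \<or> hd U \<noteq> hd V \<Longrightarrow>
    prefix w (?q U) \<Longrightarrow> prefix w (?q V) \<Longrightarrow> length w \<le> B"
    using quotient_bounded_cancellation[OF S] by metis
  have two: "2 \<le> length (proj S (h x))" if x: "x \<in> A - S" for x
  proof (rule ccontr)
    assume neg: "\<not> 2 \<le> length (proj S (h x))"
    obtain l q where lq: "h x = l @ x # q" using self x split_list by fast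
    then have "length (proj S l) + length (proj S q) = 0" using neg x by (simp del: length_0_conv)
    then have "set l \<subseteq> S" "set q \<subseteq> S" by (auto simp: filter_empty_conv)
    then have "x \<in> para S" using x lq by (auto simp: para_def)
    then show False using exp x by simp
  qed
  have double: "2 * length w \<le> length (?q w)" if "set w \<subseteq> A - S" for w
    using that
  proof (induction w)
    case (Cons x w)
    then show ?case using two[of x] by (simp add: quotient_ext_def)
  qed simp
  \<comment> \<open>A state is a pair of words without common prefix; \<open>step\<close> applies
    the induced substitution and cancels again. \<open>tr\<close> keeps only \<open>B\<close>
    letters of the absorbing word, which leaves finitely many states.\<close>
  define red where "red = (\<lambda>(U, V). let n = length (longest_common_prefix U V) in (drop n U, drop n (V :: 'a list)))"
  define step where "step = (\<lambda>(U, V). red (?q U, ?q V))"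
  define tr where "tr = (\<lambda>(U :: 'a list, V :: 'a list). (take B U, V))"
  define C where "C = {w. set w \<subseteq> A \<and> length w \<le> B} \<times> {w. set w \<subseteq> A \<and> length w \<le> B}"
  have finC: "finite C" using fin by (simp add: C_def finite_lists_length_le)
  have red: "\<exists>g. U = g @ fst (red (U, V)) \<and> V = g @ snd (red (U, V)) \<and> prefix g U \<and> prefix g V"
    "fst (red (U, V)) = [] \<or> snd (red (U, V)) = [] \<or> hd (fst (red (U, V))) \<noteq> hd (snd (red (U, V)))" for U V
    using longest_common_prefix_drop[of _ U V, OF refl] longest_common_prefix_prefix1[of U V]
      longest_common_prefix_prefix2[of U V]
    by (auto simp: red_def Let_def)
  have red_E: "?E (fst (red (U, V))) (snd (red (U, V)))" if "?E U V" for U V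
    using red(1)[of U V] that quotient_absorbs_cancel[OF S] by metis
  have "prefix ((?q ^^ card C) V) ((?q ^^ card C) U)" if E: "?E U V" for U V
  proof -
    define st where "st t = (step ^^ t) (red (U, V))" for t
    have st_Suc: "st (Suc t) = red (?q (fst (st t)), ?q (snd (st t)))" for t
      by (simp add: st_def step_def split_beta)
    have st_E: "?E (fst (st t)) (snd (st t))" for t
    proof (induction t)
      case 0
      show ?case using red_E[OF E] by (simp add: st_def)
    next
      case (Suc t)
      show ?case using red_E[OF quotient_absorbs_ext[OF S Suc]] by (simp add: st_Suc)
    qed
    have st_red: "fst (st t) = [] \<or> snd (st t) = [] \<or> hd (fst (st t)) \<noteq> hd (snd (st t))" for t
      using red(2) by (cases t) (auto simp: st_Suc st_def[of 0])
    have st_g: "\<exists>g. (?q ^^ t) U = g @ fst (st t) \<and> (?q ^^ t) V = g @ snd (st t)" for t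
    proof (induction t)
      case 0
      show ?case using red(1)[of U V] by (auto simp: st_def)
    next
      case (Suc t)
      then obtain g where g: "(?q ^^ t) U = g @ fst (st t)" "(?q ^^ t) V = g @ snd (st t)" by blast
      obtain g' where "?q (fst (st t)) = g' @ fst (st (Suc t))" "?q (snd (st t)) = g' @ snd (st (Suc t))"
        using red(1)[of "?q (fst (st t))" "?q (snd (st t))"] unfolding st_Suc by blast
      then show ?case using g
        by (intro exI[of _ "?q g @ g'"]) (simp add: quotient_ext_append)
    qed
    have st_in: "set (fst (st t)) \<subseteq> A - S" "set (snd (st t)) \<subseteq> A - S" for t
      using quotient_absorbs_subset[OF st_E] by auto
    \<comment> \<open>A reduced pair has no common first letter, so its second word can be a prefix
      of the first only if it is empty.\<close>
    have dead_iff: "snd (st t) = [] \<longleftrightarrow> prefix ((?q ^^ t) V) ((?q ^^ t) U)" for t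
    proof -
      obtain g where g: "(?q ^^ t) U = g @ fst (st t)" "(?q ^^ t) V = g @ snd (st t)"
        using st_g by blast
      have "prefix (snd (st t)) (fst (st t)) \<longleftrightarrow> snd (st t) = []"
        using st_red[of t] by (cases "snd (st t)"; cases "fst (st t)") auto
      then show ?thesis by (simp add: g)
    qed
    have dead_mono: "snd (st t') = []" if dead: "snd (st t) = []" "t \<le> t'" for t t'
    proof -
      have "prefix ((?q ^^ (t' - t)) ((?q ^^ t) V)) ((?q ^^ (t' - t)) ((?q ^^ t) U))"
        using dead(1) dead_iff prefix_quotient_ext_pow by blast
      then have "prefix ((?q ^^ (t' - t + t)) V) ((?q ^^ (t' - t + t)) U)"
        by (simp only: funpow_add comp_apply)
      then show ?thesis using dead_iff dead(2) by simp
    qed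
    obtain t0 where t0: "snd (st t0) = []"
      using quotient_absorbs_eventually[OF S E] dead_iff by blast
    have lcp_le: "length (longest_common_prefix (?q (fst (st t))) (?q (snd (st t)))) \<le> B" for t
      using B[OF st_E st_red] longest_common_prefix_prefix1 longest_common_prefix_prefix2 by blast
    \<comment> \<open>Once longer than \<open>B\<close>, the remainder doubles and loses at most
      \<open>B\<close> letters per step, so it would stay longer than \<open>B\<close> and never be
      absorbed.\<close>
    have V_le: "length (snd (st t)) \<le> B" for t
    proof (rule ccontr)
      assume neg: "\<not> length (snd (st t)) \<le> B"
      have "B < length (snd (st (i + t)))" for i
      proof (induction i)
        case (Suc i)
        have "2 * length (snd (st (i + t))) \<le> length (?q (snd (st (i + t))))"
          using double st_in by blast
        moreover have "length (?q (snd (st (i + t)))) \<le> B + length (snd (st (Suc (i + t))))"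
          using lcp_le[of "i + t"] by (simp add: st_Suc red_def Let_def)
        ultimately show ?case using Suc by simp
      qed (use neg in simp)
      from this[of t0] show False using dead_mono[OF t0, of "t0 + t"] by simp
    qed
    \<comment> \<open>The image of \<open>B\<close> letters has at least \<open>2 * B\<close>
      letters and at most \<open>B\<close> are cancelled, so the next truncated state depends only
      on the truncated one.\<close>
    have tr_step: "tr (st (Suc t)) = tr (step (tr (st t)))" for t
    proof (cases "length (fst (st t)) \<le> B")
      case True
      then show ?thesis by (simp add: tr_def step_def st_Suc split_beta)
    next
      case False
      define X where "X = take B (fst (st t))"
      define Y where "Y = drop B (fst (st t))"
      have XY: "?q (fst (st t)) = ?q X @ ?q Y"
        unfolding X_def Y_def quotient_ext_append[symmetric] by simp
      have "set X \<subseteq> A - S" using st_in(1)[of t] set_take_subset unfolding X_def by fast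
      then have lX: "2 * B \<le> length (?q X)" using double[of X] False by (simp add: X_def)
      define n where "n = length (longest_common_prefix (?q X) (?q (snd (st t))))"
      have same: "longest_common_prefix (?q X) (?q (snd (st t))) =
        longest_common_prefix (?q (fst (st t))) (?q (snd (st t)))"
        using longest_common_prefix_append[of "?q X" "?q Y"] lcp_le[of t] lX by (simp add: XY)
      have "n \<le> B" using lcp_le[of t] by (simp add: n_def same)
      then have "take B (drop n (?q X @ ?q Y)) = take B (drop n (?q X))" using lX by simp
      then show ?thesis
        using same by (simp add: tr_def step_def st_Suc split_beta red_def Let_def n_def
            flip: X_def) (simp add: XY)
    qed
    have tr_in: "tr (st t) \<in> C" for t
      using st_in[of t] V_le[of t] set_take_subset[of B "fst (st t)"]
      by (auto simp: C_def tr_def split_beta)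
    have "\<exists>t<card C. snd (tr (st t)) = []"
      by (rule funpow_finite_state_bound[where s = "\<lambda>t. tr (st t)" and P = "\<lambda>x. snd x = []",
            OF finC tr_in, of "\<lambda>x. tr (step x)" t0])
        (simp_all add: tr_step t0, simp add: tr_def split_beta t0)
    then obtain t where "t < card C" "snd (st t) = []" by (auto simp: tr_def split_beta)
    then show ?thesis using dead_mono[of t "card C"] dead_iff by simp
  qed
  then have "prefix (proj S (img (card C) v)) (proj S (img (card C) u))" if "absorbs u v" for u v
    using that quotient_ext_pow_proj[OF S] by (metis quotient_absorbs_def)
  then show ?thesis using that by blast
qed

text \<open>No separate base case arises, since \<open>para S = S\<close> holds for
  \<open>S = A\<close>. In the inductive step the times for \<open>para S\<close> and for the
  remainder over \<open>para S\<close> add up.\<close>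

lemma absorb_modulo_closed_bounded:
  assumes "closed S" "\<And>x. x \<in> A \<Longrightarrow> h x = [x] \<Longrightarrow> x \<in> S"
  shows "\<exists>T. \<forall>u v. absorbs u v \<longrightarrow> prefix (proj S (img T v)) (proj S (img T u))"
  using assms
proof (induction "card (A - S)" arbitrary: S rule: less_induct)
  case less
  note S = less.prems(1) and const = less.prems(2)
  show ?case
  proof (cases "para S = S")
    case True
    then show ?thesis using absorb_expanding_bounded[OF S] by metis
  next
    case False
    note sup = para_supset[OF S]
    have para_in: "para S \<subseteq> A" by (auto simp: para_def)
    have "A - para S \<subset> A - S" using False sup para_in by blast
    then have "card (A - para S) < card (A - S)" using fin by (simp add: psubset_card_mono)
    moreover have "x \<in> para S" if "x \<in> A" "h x = [x]" for x using const that sup by blast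
    ultimately obtain T where T: "\<And>u v. absorbs u v \<Longrightarrow>
        prefix (proj (para S) (img T v)) (proj (para S) (img T u))"
      using less.hyps[OF _ closed_para[OF S]] by metis
    obtain J where J: "\<And>u r. absorbs u r \<Longrightarrow> set r \<subseteq> para S \<Longrightarrow>
        prefix (proj S (img J r)) (proj S (img J u))"
      using absorb_para_bounded[OF S const] by metis
    have "prefix (proj S (img (J + T) v)) (proj S (img (J + T) u))" if ab: "absorbs u v" for u v
    proof -
      have abT: "absorbs (img T u) (img T v)" using absorbs_img[OF ab] .
      obtain e where "proj (para S) (img T u) = proj (para S) (img T v) @ e"
        using T[OF ab] by (auto simp: prefix_def)
      then obtain w u' r where w: "img T u = w @ u'" "img T v = w @ r" "proj (para S) r = []"
        using absorbs_split[OF abT closed_para[OF S], of "proj (para S) (img T v)" e "[]"]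
        by (metis append_Nil2)
      have "absorbs u' r" using abT absorbs_cancel w by simp
      moreover have "set r \<subseteq> para S" using w(3) by (auto simp: filter_empty_conv)
      ultimately have "prefix (proj S (img J r)) (proj S (img J u'))" using J by blast
      then show ?thesis by (simp add: ext_pow_add w)
    qed
    then show ?thesis by blast
  qed
qed

section \<open>Remainders made of constant letters\<close>

lemma img_constants: "\<forall>x\<in>set w. h x = [x] \<Longrightarrow> img k w = w"
proof (induction k)
  case (Suc k)
  have "ext h w = w" using Suc.prems by (induction w) auto
  then show ?case using Suc by simp
qed simp

text \<open>After time \<open>m\<close> the letters before \<open>z\<close> are constant and each
  step appends the same \<open>p\<close>. If \<open>p\<close> is empty nothing changes; otherwise
  \<open>length r\<close> steps supply at least \<open>length r\<close> letters.\<close>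

lemma absorb_constants_bounded:
  obtains m where "\<And>u r. absorbs u r \<Longrightarrow> \<forall>x\<in>set r. h x = [x] \<Longrightarrow>
    prefix (img (length r + m) r) (img (length r + m) u)"
proof -
  define S where "S = {x \<in> A. h x = [x]}"
  have S: "closed S" by (auto simp: closed_def S_def)
  have const: "img k w = w" if "set w \<subseteq> S" for k w
    using img_constants that by (auto simp: S_def)
  obtain m where m: "\<And>u. set u \<subseteq> A \<Longrightarrow> \<not> set u \<subseteq> S \<Longrightarrow>
    \<exists>d z p s u'. img m u = d @ z # u' \<and> h z = p @ z # s \<and> set d \<subseteq> S \<and> set p \<subseteq> S \<and> z \<in> A - S"
    using front_normal_form[OF S] by metis
  have "prefix (img (length r + m) r) (img (length r + m) u)"
    if ab: "absorbs u r" and r: "\<forall>x\<in>set r. h x = [x]" for u r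
  proof -
    have uA: "set u \<subseteq> A" and rS: "set r \<subseteq> S" using ab r by (auto simp: absorbs_def S_def)
    show ?thesis
    proof (cases "set u \<subseteq> S")
      case True
      then show ?thesis using ab const rS by (auto simp: absorbs_def)
    next
      case False
      then obtain d z p s u' where u1: "img m u = d @ z # u'" and z: "h z = p @ z # s" "z \<notin> S"
        and d: "set d \<subseteq> S" and p: "set p \<subseteq> S"
        using m[OF uA] by blast
      define W where "W t = ((\<lambda>x. x @ p) ^^ t) d" for t
      have W_Suc: "W (Suc t) = W t @ p" for t by (simp add: W_def)
      have W_in: "set (W t) \<subseteq> S" for t
        by (induction t) (auto simp: W_Suc d p, use d in \<open>auto simp: W_def\<close>)
      have W_img: "\<exists>w. img t (img m u) = W t @ z # w" for t
      proof (induction t)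
        case 0
        show ?case by (simp add: W_def u1)
      next
        case (Suc t)
        then obtain w where w: "img t (img m u) = W t @ z # w" by blast
        have "ext h (W t) = W t" using const[OF W_in, of 1] by simp
        then show ?case by (simp add: w z W_Suc)
      qed
      have W_mono: "prefix (W i) (W j)" if "i \<le> j" for i j
        using that by (induction j rule: dec_induct) (simp_all add: W_Suc prefix_prefix)
      have "absorbs (img m u) r" using absorbs_img[OF ab, of m] by (simp add: const[OF rS])
      then obtain t where "prefix (img t r) (img t (img m u))" by (auto simp: absorbs_def)
      then obtain w where "prefix r (W t @ z # w)" using W_img[of t] const[OF rS] by auto
      moreover have "z \<notin> set r" using z(2) rS by auto
      ultimately have pre: "prefix r (W t)" by (rule prefix_append_Cons_notin)
      have "prefix r (W (length r))"
      proof (cases "t \<le> length r \<or> p = []")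
        case True
        have "W i = d" if "p = []" for i using that by (induction i) (simp_all add: W_def)
        then have "W t = W (length r)" if "p = []" using that by metis
        then show ?thesis using True pre W_mono[of t "length r"] prefix_order.trans[of r "W t"]
          by auto
      next
        case False
        have "i \<le> length (W i)" for i
        proof (induction i)
          case (Suc i)
          then show ?case using False by (cases p) (auto simp: W_Suc)
        qed simp
        then show ?thesis using prefix_length_prefix[OF pre W_mono] False by simp
      qed
      then show ?thesis using W_img[of "length r"] const[OF rS]
        by (auto simp: ext_pow_add prefix_prefix)
    qed
  qed
  then show ?thesis using that by blast
qed

theorem absorb_bounded:
  "\<exists>T. \<forall>u v x. absorbs u (v @ [x]) \<longrightarrow> h x \<noteq> [x] \<longrightarrow>
    prefix (img T (v @ [x])) (img T u)"
proof -
  define S where "S = {x \<in> A. h x = [x]}"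
  have S: "closed S" by (auto simp: closed_def S_def)
  obtain T where T: "\<And>u v. absorbs u v \<Longrightarrow> prefix (proj S (img T v)) (proj S (img T u))"
    using absorb_modulo_closed_bounded[OF S] by (auto simp: S_def)
  obtain m where m: "\<And>u r. absorbs u r \<Longrightarrow> \<forall>x\<in>set r. h x = [x] \<Longrightarrow>
    prefix (img (length r + m) r) (img (length r + m) u)"
    using absorb_constants_bounded by metis
  define L where "L = (\<Sum>x\<in>A. length (img T [x]))"
  have "prefix (img (L + m + T) (v @ [x])) (img (L + m + T) u)"
    if ab: "absorbs u (v @ [x])" and x: "h x \<noteq> [x]" for u v x
  proof -
    have xA: "x \<in> A" using ab by (simp add: absorbs_def)
    have abT: "absorbs (img T u) (img T (v @ [x]))" using absorbs_img[OF ab] .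
    obtain e where "proj S (img T u) = proj S (img T (v @ [x])) @ e"
      using T[OF ab] by (auto simp: prefix_def)
    then obtain w u' r where w: "img T u = w @ u'" "img T (v @ [x]) = w @ r" "proj S r = []"
      using absorbs_split[OF abT S, of "proj S (img T (v @ [x]))" e "[]"]
      by (metis append_Nil2)
    have abr: "absorbs u' r" using abT absorbs_cancel unfolding w by blast
    have rS: "set r \<subseteq> S" using w(3) by (auto simp: filter_empty_conv)
    \<comment> \<open>A longer \<open>r\<close> would end with all of \<open>img T [x]\<close> and
      so contain the nonconstant \<open>x\<close>. Thus \<open>L\<close> bounds the remainder
      independently of \<open>u\<close> and \<open>v\<close>.\<close>
    have "length r \<le> length (img T [x])"
    proof (rule ccontr)
      assume neg: "\<not> length r \<le> length (img T [x])"
      have "w @ r = img T v @ img T [x]" using w(2) by simp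
      then have "\<exists>a. r = a @ img T [x]"
        using neg by (auto simp: append_eq_append_conv2 dest: arg_cong[of _ _ length])
      then have "x \<in> S" using img_self[OF xA, of "[x]" T] rS by auto
      then show False using x by (simp add: S_def)
    qed
    also have "\<dots> \<le> L" unfolding L_def using fin xA by (intro member_le_sum) auto
    finally have rL: "length r + m \<le> L + m" by simp
    have "\<forall>x\<in>set r. h x = [x]" using rS by (auto simp: S_def)
    then have "prefix (img (L + m) r) (img (L + m) u')"
      using prefix_img_mono[OF m[OF abr] rL] by blast
    then have "prefix (img (L + m) (w @ r)) (img (L + m) (w @ u'))" by simp
    then show ?thesis unfolding ext_pow_add[of "L + m" T h] w .
  qed
  then show ?thesis by blast
qed

end

section \<open>Positive automorphisms of free groups\<close>

locale free_group_basis = group F for F :: "('a, 'b) monoid_scheme" (structure) +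
  fixes A :: "'a set"
  assumes free: "free_group_on F A"
begin

text \<open>The reversal is built in here, so that cancelling on the right becomes removing a
  prefix; products therefore change order in \<open>pval_append\<close>.\<close>

definition pval :: "'a list \<Rightarrow> 'a" where
  "pval w = word_value F (map Pos (rev w))"

lemma A_carrier: "x \<in> A \<Longrightarrow> x \<in> carrier F"
  using free by (auto simp: free_group_on_def)

lemma words_Nil [simp]: "[] \<in> words A"
  and words_Cons [simp]: "l # w \<in> words A \<longleftrightarrow> l \<in> Pos ` A \<union> Neg ` A \<and> w \<in> words A"
  and words_append [simp]: "u @ v \<in> words A \<longleftrightarrow> u \<in> words A \<and> v \<in> words A"
  by (auto simp: words_def)

lemma words_map_Pos [simp]: "map Pos w \<in> words A \<longleftrightarrow> set w \<subseteq> A"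
  by (induction w) auto

lemma words_map_Neg [simp]: "map Neg w \<in> words A \<longleftrightarrow> set w \<subseteq> A"
  by (induction w) auto

lemma letter_value_closed: "l \<in> Pos ` A \<union> Neg ` A \<Longrightarrow> letter_value F l \<in> carrier F"
  using A_carrier by auto

lemma word_value_closed: "w \<in> words A \<Longrightarrow> word_value F w \<in> carrier F"
proof (induction w)
  case (Cons l w)
  then show ?case using letter_value_closed[of l] by simp
qed simp

lemma word_value_append:
  "u \<in> words A \<Longrightarrow> v \<in> words A \<Longrightarrow> word_value F (u @ v) = word_value F u \<otimes> word_value F v"
proof (induction u)
  case (Cons l u)
  then show ?case using letter_value_closed[of l] by (simp add: word_value_closed m_assoc)
qed (simp add: word_value_closed)

lemma reduced_word_value:
  assumes "w \<in> words A" "reduced w" shows "reduced_word F A (word_value F w) = w"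
proof -
  have "\<exists>!w'. w' \<in> words A \<and> reduced w' \<and> word_value F w' = word_value F w"
    using free word_value_closed[OF assms(1)] unfolding free_group_on_def by blast
  then show ?thesis unfolding reduced_word_def using assms by (intro the1_equality) auto
qed

lemma reduced_word_props:
  assumes "g \<in> carrier F"
  shows "reduced_word F A g \<in> words A" "word_value F (reduced_word F A g) = g"
proof -
  have "\<exists>!w'. w' \<in> words A \<and> reduced w' \<and> word_value F w' = g"
    using free assms unfolding free_group_on_def by blast
  from theI'[OF this] show "reduced_word F A g \<in> words A" "word_value F (reduced_word F A g) = g"
    unfolding reduced_word_def by auto
qed

lemma reduced_map_Pos: "reduced (map Pos w)"
  unfolding reduced_def by (induction w rule: induct_list012) auto

lemma reduced_map_Neg: "reduced (map Neg w)"
  unfolding reduced_def by (induction w rule: induct_list012) auto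

lemma positive_wordE:
  assumes "w \<in> words A" "positive_word w"
  obtains u where "w = map Pos (rev u)" "set u \<subseteq> A"
proof -
  have "\<exists>u. w = map Pos u \<and> set u \<subseteq> A"
    using assms
  proof (induction w)
    case (Cons l w)
    then obtain u where "w = map Pos u" "set u \<subseteq> A" by (auto simp: positive_word_def)
    moreover obtain x where "l = Pos x" "x \<in> A" using Cons.prems by (auto simp: positive_word_def)
    ultimately show ?case by (intro exI[of _ "x # u"]) simp
  qed simp
  then obtain u where "w = map Pos u" "set u \<subseteq> A" by blast
  then show ?thesis using that[of "rev u"] by simp
qed

lemma pval_closed: "set w \<subseteq> A \<Longrightarrow> pval w \<in> carrier F"
  by (simp add: pval_def word_value_closed)

lemma pval_append: "set u \<subseteq> A \<Longrightarrow> set v \<subseteq> A \<Longrightarrow> pval (u @ v) = pval v \<otimes> pval u"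
  by (simp add: pval_def word_value_append)

lemma pval_single: "x \<in> A \<Longrightarrow> pval [x] = x"
  by (simp add: pval_def A_carrier)

lemma reduced_word_pval: "set w \<subseteq> A \<Longrightarrow> reduced_word F A (pval w) = map Pos (rev w)"
  by (simp add: pval_def reduced_word_value reduced_map_Pos)

lemma map_Pos_inj: "map Pos u = map Pos v \<Longrightarrow> u = v"
  by (rule map_injective) (auto simp: inj_def)

lemma pval_inj:
  assumes "set u \<subseteq> A" "set v \<subseteq> A" "pval u = pval v" shows "u = v"
proof -
  have "map Pos (rev u) = map Pos (rev v)" using assms reduced_word_pval by metis
  then have "rev u = rev v" by (rule map_Pos_inj)
  then show ?thesis by simp
qed

lemma positive_element_iff:
  assumes "g \<in> carrier F"
  shows "positive_element F A g \<longleftrightarrow> (\<exists>w. set w \<subseteq> A \<and> g = pval w)"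
proof
  assume "positive_element F A g"
  then have "positive_word (reduced_word F A g)" by (simp add: positive_element_def)
  then obtain u where "reduced_word F A g = map Pos (rev u)" "set u \<subseteq> A"
    using positive_wordE reduced_word_props(1)[OF assms] by blast
  then show "\<exists>w. set w \<subseteq> A \<and> g = pval w"
    using reduced_word_props(2)[OF assms] by (auto simp: pval_def intro!: exI[of _ u])
next
  assume "\<exists>w. set w \<subseteq> A \<and> g = pval w"
  then show "positive_element F A g"
    by (auto simp: positive_element_def reduced_word_pval positive_word_def)
qed

text \<open>A positive quotient with word \<open>w\<close> means
  \<open>pval a = pval w \<otimes> pval b\<close>, which by uniqueness of reduced words says
  \<open>a = b @ w\<close>.\<close>

lemma positive_quotient_iff:
  assumes a: "set a \<subseteq> A" and b: "set b \<subseteq> A"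
  shows "positive_element F A (pval a \<otimes> inv (pval b)) \<longleftrightarrow> prefix b a"
proof -
  note ca = pval_closed[OF a] and cb = pval_closed[OF b]
  have "pval a \<otimes> inv (pval b) = pval w \<longleftrightarrow> a = b @ w" if w: "set w \<subseteq> A" for w
  proof -
    have "pval a \<otimes> inv (pval b) = pval w \<longleftrightarrow> pval a = pval w \<otimes> pval b"
      using ca cb pval_closed[OF w] by (metis inv_solve_right')
    also have "\<dots> \<longleftrightarrow> pval a = pval (b @ w)" using pval_append[OF b w] by simp
    also have "\<dots> \<longleftrightarrow> a = b @ w" using pval_inj[of a "b @ w"] a b w by auto
    finally show ?thesis .
  qed
  then show ?thesis
    using positive_element_iff[of "pval a \<otimes> inv (pval b)"] ca cb a unfolding prefix_def
    by (metis inv_closed le_sup_iff m_closed set_append)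
qed

lemma inv_pval: "set v \<subseteq> A \<Longrightarrow> inv (pval v) = word_value F (map Neg v)"
proof (induction v)
  case Nil
  then show ?case by (simp add: pval_def)
next
  case (Cons x v)
  then have "pval (x # v) = pval v \<otimes> x" using pval_append[of "[x]" v] pval_single[of x] by simp
  then show ?case using Cons A_carrier[of x] pval_closed[of v] by (simp add: inv_mult_group)
qed

text \<open>At the junction \<open>Pos (hd u)\<close> meets \<open>Neg (hd v)\<close>, and these do
  not cancel by \<open>ne\<close>.\<close>

lemma reduced_word_quotient:
  assumes u: "set u \<subseteq> A" and v: "set v \<subseteq> A" and ne: "u = [] \<or> v = [] \<or> hd u \<noteq> hd v"
  shows "reduced_word F A (pval u \<otimes> inv (pval v)) = map Pos (rev u) @ map Neg v"
proof -
  have "pval u \<otimes> inv (pval v) = word_value F (map Pos (rev u) @ map Neg v)"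
    using u v by (simp add: inv_pval word_value_append) (simp add: pval_def)
  moreover have "reduced (map Pos (rev u) @ map Neg v)"
    using reduced_map_Pos[of "rev u"] reduced_map_Neg[of v] ne
    unfolding reduced_def successively_append_iff
    by (cases u; cases v) (auto simp: last_map hd_map)
  ultimately show ?thesis using u v reduced_word_value by simp
qed

end

text \<open>Only the image of the last letter reached can be incomplete, and it accounts for
  \<open>e\<close>.\<close>

lemma prefix_ext_decompose:
  assumes "\<And>x. x \<in> set u \<Longrightarrow> length (h x) \<le> M" "prefix w (ext h u)"
  shows "\<exists>u1 e. prefix u1 u \<and> w = ext h u1 @ e \<and> length e \<le> M"
  using assms
proof (induction u arbitrary: w)
  case Nil
  then show ?case by simp
next
  case (Cons x u)
  from Cons.prems(2) consider "prefix w (h x)" | w' where "w = h x @ w'" "prefix w' (ext h u)"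
    by (auto simp: prefix_append)
  then show ?case
  proof cases
    case 1
    then have "length w \<le> M" using Cons.prems(1)[of x] prefix_length_le[OF 1] by simp
    then show ?thesis by (intro exI[of _ "[]"] exI[of _ w]) simp
  next
    case 2
    then obtain u1 e where "prefix u1 u" "w' = ext h u1 @ e" "length e \<le> M"
      using Cons.IH[of w'] Cons.prems(1) by auto
    then show ?thesis using 2 by (intro exI[of _ "x # u1"] exI[of _ e]) simp
  qed
qed

lemma length_ext_le:
  assumes "\<And>x. x \<in> set u \<Longrightarrow> length (h x) \<le> M"
  shows "length (ext h u) \<le> M * length u"
  using assms
proof (induction u)
  case (Cons x u)
  then have "length (h x) \<le> M" "length (ext h u) \<le> M * length u" by simp_all
  then show ?case by simp
qed simp

lemma find_map_Pos: "find (\<lambda>l. l \<in> Pos ` S) (map Pos w) = map_option Pos (find (\<lambda>y. y \<in> S) w)"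
  by (induction w) auto

section \<open>The automorphism as a substitution on letters\<close>

locale positive_automorphism = free_group_basis F A
  for F :: "('a, 'b) monoid_scheme" (structure) and A +
  fixes \<phi> :: "'a \<Rightarrow> 'a" and h :: "'a \<Rightarrow> 'a list"
  assumes fin: "finite A" and iso: "\<phi> \<in> iso F F"
    and h_in: "x \<in> A \<Longrightarrow> set (h x) \<subseteq> A" and h_val: "x \<in> A \<Longrightarrow> pval (h x) = \<phi> x"
begin

lemma hom: "group_hom F F \<phi>"
  using iso by (simp add: group_hom_def group_hom_axioms_def iso_def is_group)

lemma inj_phi: "inj_on \<phi> (carrier F)"
  using iso by (simp add: iso_def bij_betw_def)

lemma ext_in: "set w \<subseteq> A \<Longrightarrow> set (ext h w) \<subseteq> A"
  using h_in by (auto simp: set_ext)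

lemma ext_pow_in: "set w \<subseteq> A \<Longrightarrow> set ((ext h ^^ k) w) \<subseteq> A"
  by (induction k) (simp_all add: ext_in)

lemma phi_pval: "set w \<subseteq> A \<Longrightarrow> \<phi> (pval w) = pval (ext h w)"
proof (induction w)
  case Nil
  then show ?case using group_hom.hom_one[OF hom] by (simp add: pval_def)
next
  case (Cons x w)
  then have x: "x \<in> A" and w: "set w \<subseteq> A" by auto
  have "pval (x # w) = pval w \<otimes> x" using pval_append[of "[x]" w] pval_single x w by simp
  then have "\<phi> (pval (x # w)) = pval (ext h w) \<otimes> pval (h x)"
    using Cons.IH[OF w] h_val[OF x] group_hom.hom_mult[OF hom] pval_closed[OF w] A_carrier[OF x] by simp
  then show ?case using pval_append[OF h_in[OF x] ext_in[OF w]] by simp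
qed

lemma phi_pow_pval: "set w \<subseteq> A \<Longrightarrow> (\<phi> ^^ k) (pval w) = pval ((ext h ^^ k) w)"
  by (induction k) (simp_all add: phi_pval ext_pow_in)

lemma phi_pow_quotient:
  assumes "set a \<subseteq> A" "set b \<subseteq> A"
  shows "(\<phi> ^^ k) (pval a \<otimes> inv (pval b)) = pval ((ext h ^^ k) a) \<otimes> inv (pval ((ext h ^^ k) b))"
proof (induction k)
  case (Suc k)
  then show ?case
    using group_hom.hom_mult[OF hom] group_hom.hom_inv[OF hom] pval_closed ext_pow_in[of _ k] assms
    by (simp add: phi_pval)
qed simp

lemma image_word_eq:
  assumes "x \<in> A" shows "image_word F A \<phi> j x = map Pos (rev ((ext h ^^ j) [x]))"
proof -
  have "(\<phi> ^^ j) x = pval ((ext h ^^ j) [x])"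
    using phi_pow_pval[of "[x]" j] pval_single assms by simp
  then show ?thesis using reduced_word_pval ext_pow_in[of "[x]" j] assms by (simp add: image_word_def)
qed

lemma Supp_eq: "x \<in> A \<Longrightarrow> Supp F A \<phi> x = letter_supp h x"
  by (auto simp: Supp_def letter_supp_def image_word_eq)

lemma letter_supp_in: "x \<in> A \<Longrightarrow> letter_supp h x \<subseteq> A"
  using ext_pow_in[of "[x]"] by (auto simp: letter_supp_def)

lemma stratum_eq: "x \<in> A \<Longrightarrow> stratum F A \<phi> x = letter_stratum h x"
  using letter_supp_in[of x] Supp_eq by (auto simp: stratum_def letter_stratum_def)

text \<open>Two words with a long common prefix of their images yield, up to the two incomplete last
  letters, a reduced word whose image under \<open>\<phi>\<close> lies in a fixed finite set.\<close>

lemma bounded_cancellation_ext: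
  "\<exists>B. \<forall>u v w. set u \<subseteq> A \<longrightarrow> set v \<subseteq> A \<longrightarrow> (u = [] \<or> v = [] \<or> hd u \<noteq> hd v) \<longrightarrow>
     prefix w (ext h u) \<longrightarrow> prefix w (ext h v) \<longrightarrow> length w \<le> B"
proof -
  define M where "M = (\<Sum>x\<in>A. length (h x))"
  have M: "length (h x) \<le> M" if "x \<in> A" for x
    unfolding M_def using fin that by (intro member_le_sum) auto
  define K where "K = {w. set w \<subseteq> A \<and> length w \<le> M}"
  have finK: "finite K" using fin by (simp add: K_def finite_lists_length_le)
  \<comment> \<open>Collects all quotients of \<open>u1\<close> by \<open>v1\<close> that can arise
    below. It is finite because \<phi> is injective and the values come from pairs of words of
    length at most \<open>M\<close>.\<close>
  define G where "G = {g \<in> carrier F. \<phi> g \<in> (\<lambda>(e, e'). inv (pval e) \<otimes> pval e') ` (K \<times> K)}"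
  have "\<phi> ` G \<subseteq> (\<lambda>(e, e'). inv (pval e) \<otimes> pval e') ` (K \<times> K)" by (auto simp: G_def)
  then have "finite (\<phi> ` G)" using finK by (meson finite_SigmaI finite_imageI finite_subset)
  moreover have "inj_on \<phi> G" using inj_phi by (rule inj_on_subset) (auto simp: G_def)
  ultimately have finG: "finite G" by (simp add: finite_image_iff)
  \<comment> \<open>The reduced word of such a quotient contains all of \<open>u1\<close>, so
    \<open>N\<close> bounds the length of \<open>u1\<close>.\<close>
  define N where "N = (\<Sum>g\<in>G. length (reduced_word F A g))"
  have "length w \<le> M * N + M"
    if uv: "set u \<subseteq> A" "set v \<subseteq> A" "u = [] \<or> v = [] \<or> hd u \<noteq> hd v"
      and w: "prefix w (ext h u)" "prefix w (ext h v)" for u v w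
  proof -
    obtain u1 e where u1: "prefix u1 u" "w = ext h u1 @ e" "length e \<le> M"
      using prefix_ext_decompose[OF _ w(1), of M] M uv(1) by blast
    obtain v1 e' where v1: "prefix v1 v" "w = ext h v1 @ e'" "length e' \<le> M"
      using prefix_ext_decompose[OF _ w(2), of M] M uv(2) by blast
    have A1: "set u1 \<subseteq> A" "set v1 \<subseteq> A" using u1(1) v1(1) uv set_mono_prefix by blast+
    have wA: "set w \<subseteq> A" using w(1) ext_in[OF uv(1)] set_mono_prefix by blast
    then have eA: "set e \<subseteq> A" "set e' \<subseteq> A" using u1(2) v1(2) by (metis le_sup_iff set_append)+
    have ne: "u1 = [] \<or> v1 = [] \<or> hd u1 \<noteq> hd v1"
      using u1(1) v1(1) uv(3) by (auto simp: prefix_def)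
    let ?g = "pval u1 \<otimes> inv (pval v1)"
    note cl = pval_closed[OF A1(1)] pval_closed[OF A1(2)] pval_closed[OF eA(1)] pval_closed[OF eA(2)]
      pval_closed[OF ext_in[OF A1(1)]] pval_closed[OF ext_in[OF A1(2)]]
    have "pval e \<otimes> pval (ext h u1) = pval e' \<otimes> pval (ext h v1)"
      using u1(2) v1(2) pval_append[OF ext_in[OF A1(1)] eA(1)] pval_append[OF ext_in[OF A1(2)] eA(2)]
      by simp
    then have "pval (ext h u1) = inv (pval e) \<otimes> (pval e' \<otimes> pval (ext h v1))"
      using cl by (simp add: inv_solve_left)
    then have "pval (ext h u1) \<otimes> inv (pval (ext h v1)) = inv (pval e) \<otimes> pval e'"
      using cl by (simp add: m_assoc)
    then have "\<phi> ?g = inv (pval e) \<otimes> pval e'"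
      using phi_pow_quotient[OF A1, of 1] by simp
    moreover have "(e, e') \<in> K \<times> K" using u1(3) v1(3) eA by (simp add: K_def)
    ultimately have "\<phi> ?g \<in> (\<lambda>(e, e'). inv (pval e) \<otimes> pval e') ` (K \<times> K)"
      by (intro image_eqI[of _ _ "(e, e')"]) simp_all
    then have "?g \<in> G" using cl(1,2) unfolding G_def by simp
    then have "length (reduced_word F A ?g) \<le> N"
      unfolding N_def using finG by (intro member_le_sum) auto
    then have "length u1 \<le> N" by (simp add: reduced_word_quotient[OF A1 ne])
    then have "M * length u1 \<le> M * N" by simp
    moreover have "length (ext h u1) \<le> M * length u1" 
      by (rule length_ext_le) (use M A1(1) in auto)
    ultimately have "length (ext h u1) \<le> M * N" by (rule order.trans[rotated])
    then show ?thesis using u1(2,3) by simp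
  qed
  then show ?thesis by blast
qed

lemma positive_substitution:
  assumes cond: "conditioned F A \<phi>"
  shows "positive_substitution A h"
proof
  have stable: "\<forall>x\<in>A. \<forall>j\<ge>1. \<forall>S \<in> stratum F A \<phi> ` A. S \<subseteq> Supp F A \<phi> x \<longrightarrow>
      rightmost_from S (image_word F A \<phi> j x) = rightmost_from S (image_word F A \<phi> 1 x)"
    using cond unfolding conditioned_def by meson
  show "x \<in> set (h x)" if "x \<in> A" for x
    using cond that by (auto simp: conditioned_def image_word_eq)
  show "u = v" if "set u \<subseteq> A" "set v \<subseteq> A" "ext h u = ext h v" for u v
  proof -
    have "\<phi> (pval u) = \<phi> (pval v)" using that phi_pval by simp
    then have "pval u = pval v" using inj_phi pval_closed that by (auto dest: inj_onD)
    then show ?thesis using pval_inj that by blast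
  qed
  show "find (\<lambda>y. y \<in> letter_stratum h x) ((ext h ^^ Suc j) [x]) =
      find (\<lambda>y. y \<in> letter_stratum h x) (h x)" if x: "x \<in> A" for x j
  proof -
    have sub: "stratum F A \<phi> x \<subseteq> Supp F A \<phi> x" by (auto simp: stratum_def)
    \<comment> \<open>Undoing the reversal turns \<open>rightmost_from\<close> into a plain
      \<open>find\<close> on the words of \<open>h\<close>.\<close>
    have "rightmost_from (stratum F A \<phi> x) (image_word F A \<phi> (Suc j) x) =
        rightmost_from (stratum F A \<phi> x) (image_word F A \<phi> 1 x)"
      by (rule stable[rule_format, OF x _ imageI[OF x] sub]) simp
    then have eq: "map_option Pos (find (\<lambda>y. y \<in> letter_stratum h x) ((ext h ^^ Suc j) [x])) =
        map_option Pos (find (\<lambda>y. y \<in> letter_stratum h x) ((ext h ^^ 1) [x]))"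
      unfolding rightmost_from_def image_word_eq[OF x] stratum_eq[OF x] rev_map rev_rev_ident
        find_map_Pos .
    have "inj (map_option Pos :: 'a option \<Rightarrow> _)" by (rule option.inj_map) (simp add: inj_def)
    from injD[OF this eq] show ?thesis by simp
  qed
qed (rule fin bounded_cancellation_ext | erule h_in)+

end

theorem corollary1p8p5:
  fixes F :: "('a, 'b) monoid_scheme" and A :: "'a set" and \<phi> :: "'a \<Rightarrow> 'a"
  assumes "free_group_on F A" and "finite A"
    and "\<phi> \<in> iso F F" and "positive_map F A \<phi>" and "conditioned F A \<phi>"
  shows "\<exists>T\<^sub>0'::nat. \<forall>U\<in>words A. \<forall>V\<in>words A.
           positive_word U \<longrightarrow> positive_word V \<longrightarrow>
           (\<exists>x V'. V = Pos x # V' \<and> \<phi> x \<noteq> x) \<longrightarrow>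
           (\<exists>k>0. positive_element F A
              ((\<phi> ^^ k) (word_value F U \<otimes>\<^bsub>F\<^esub> inv\<^bsub>F\<^esub> (word_value F V)))) \<longrightarrow>
           (LEAST k. k > 0 \<and> positive_element F A
              ((\<phi> ^^ k) (word_value F U \<otimes>\<^bsub>F\<^esub> inv\<^bsub>F\<^esub> (word_value F V)))) < T\<^sub>0'"
proof -
  interpret group F using assms(1) by (simp add: free_group_on_def)
  interpret free_group_basis F A by unfold_locales (rule assms(1))
  have "\<exists>w. set w \<subseteq> A \<and> pval w = \<phi> x" if x: "x \<in> A" for x
  proof -
    have "\<phi> x \<in> carrier F" using assms(3) A_carrier[OF x] by (auto simp: iso_def hom_def)
    moreover have "positive_element F A (\<phi> x)" using assms(4) x by (simp add: positive_map_def)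
    ultimately show ?thesis using positive_element_iff by metis
  qed
  then obtain h where h: "\<And>x. x \<in> A \<Longrightarrow> set (h x) \<subseteq> A" "\<And>x. x \<in> A \<Longrightarrow> pval (h x) = \<phi> x" by metis
  interpret positive_automorphism F A \<phi> h by unfold_locales (use assms h in auto)
  interpret P: positive_substitution A h by (rule positive_substitution[OF assms(5)])
  obtain T where T: "\<And>u v x. P.absorbs u (v @ [x]) \<Longrightarrow> h x \<noteq> [x] \<Longrightarrow>
      prefix ((ext h ^^ T) (v @ [x])) ((ext h ^^ T) u)"
    using P.absorb_bounded by metis
  show ?thesis
  \<comment> \<open>The exponent must be positive while \<open>T\<close> may be zero, hence
    \<open>Suc T\<close>; the strict inequality costs one more.\<close>
  proof (intro exI[of _ "Suc (Suc T)"] ballI impI)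
    fix U V
    assume UV: "U \<in> words A" "V \<in> words A" "positive_word U" "positive_word V"
      and x: "\<exists>x V'. V = Pos x # V' \<and> \<phi> x \<noteq> x"
      and k: "\<exists>k>0. positive_element F A ((\<phi> ^^ k) (word_value F U \<otimes>\<^bsub>F\<^esub> inv\<^bsub>F\<^esub> (word_value F V)))"
    obtain u where u: "U = map Pos (rev u)" "set u \<subseteq> A" using positive_wordE UV by blast
    obtain v where v: "V = map Pos (rev v)" "set v \<subseteq> A" using positive_wordE UV by blast
    have pos: "positive_element F A ((\<phi> ^^ k) (word_value F U \<otimes>\<^bsub>F\<^esub> inv\<^bsub>F\<^esub> (word_value F V))) \<longleftrightarrow>
        prefix ((ext h ^^ k) v) ((ext h ^^ k) u)" for k
      using phi_pow_quotient[OF u(2) v(2), of k] positive_quotient_iff ext_pow_in u v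
      by (simp add: pval_def[symmetric])
    obtain x V' where x: "V = Pos x # V'" "\<phi> x \<noteq> x" using x by blast
    \<comment> \<open>Reversal makes the nonconstant first letter of \<open>V\<close> the last
      letter of \<open>v\<close>, as \<open>P.absorb_bounded\<close> requires.\<close>
    then obtain v' where v': "v = v' @ [x]" using v(1) by (cases v rule: rev_cases) auto
    have "x \<in> A" using v(2) v' by simp
    then have "h x \<noteq> [x]" using x(2) h(2)[of x] pval_single by auto
    moreover have "P.absorbs u (v' @ [x])"
      using k u(2) v(2) v' by (auto simp: pos P.absorbs_def)
    ultimately have "prefix ((ext h ^^ T) v) ((ext h ^^ T) u)" using T v' by blast
    then have "prefix ((ext h ^^ Suc T) v) ((ext h ^^ Suc T) u)" by (rule P.prefix_img_mono) simp
    then have "(LEAST k. k > 0 \<and> positive_element F A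
        ((\<phi> ^^ k) (word_value F U \<otimes>\<^bsub>F\<^esub> inv\<^bsub>F\<^esub> (word_value F V)))) \<le> Suc T"
      by (intro Least_le) (simp only: pos, simp)
    then show "(LEAST k. k > 0 \<and> positive_element F A
        ((\<phi> ^^ k) (word_value F U \<otimes>\<^bsub>F\<^esub> inv\<^bsub>F\<^esub> (word_value F V)))) < Suc (Suc T)" by simp
  qed
qed

end
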